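(* Let $E$ be a JB$^*$-triple and let $T:E\to E$ be a weak-local triple derivation. Then $T$ is dissipative, and hence continuous.
   Context: A JB$^*$-triple is a complex Banach space $E$ with a continuous triple product $\{\cdot,\cdot,\cdot\}:E\times E\times E\to E$, $(x,y,z)\mapsto\{x,y,z\}$, linear and symmetric in $x$ and $z$ and conjugate linear in $y$, satisfying the Jordan identity $\{x,y,\{a,b,c\}\}=\{\{x,y,a\},b,c\}-\{a,\{y,x,b\},c\}+\{a,b,\{x,y,c\}\}$ for all $x,y,a,b,c\in E$, and such that for each $a\in E$ the operator $L(a,a):x\mapsto\{a,a,x\}$ is hermitian with non-negative spectrum and $\|L(a,a)\|=\|a\|^2$. A triple derivation on $E$ is a linear map $\delta:E\to E$ with $\delta\{a,b,c\}=\{\delta(a),b,c\}+\{a,\delta(b),c\}+\{a,b,\delta(c)\}$ for all $a,b,c\in E$ (no continuity is assumed). A weak-local triple derivation on $E$ is a linear map $T:E\to E$ (not assumed continuous) such that for each $\phi\in E^*$ and each $a\in E$ there exists a triple derivation $\delta_{a,\phi}:E\to E$, depending on $\phi$ and $a$, with $\phi(T(a))=\phi(\delta_{a,\phi}(a))$. A linear map $T:E\to E$ is dissipative if $\mathrm{Re}\,\phi(T(x))\le 0$ for every $\phi\in E^*$ and every $x\in E$ with $\phi(x)=1=\|x\|=\|\phi\|$. *)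

theory Defs
  imports "HOL-Analysis.Analysis"
begin

text \<open>
  The class \<^class>\<open>banach\<close> provides the real Banach space underlying \<open>E\<close>; the complex
  structure is a scalar multiplication \<open>s\<close> extending the real one, for which the norm is
  absolutely homogeneous. Complex linearity is \<open>Vector_Spaces.linear\<close> over
  the field of complex numbers.
\<close>

locale complex_banach_space = vector_space s
  for s :: "complex \<Rightarrow> 'a::banach \<Rightarrow> 'a" +
  assumes scale_of_real: "s (complex_of_real r) x = r *\<^sub>R x"
    and norm_scale: "norm (s c x) = cmod c * norm x"

text \<open>
  For complex linear maps \<^const>\<open>bounded_linear\<close> only adds continuity, and \<^const>\<open>onorm\<close>
  is the operator norm.
\<close>

definition bounded_operator :: "(complex \<Rightarrow> 'a::banach \<Rightarrow> 'a) \<Rightarrow> ('a \<Rightarrow> 'a) \<Rightarrow> bool"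
  where "bounded_operator s H \<longleftrightarrow> Vector_Spaces.linear s s H \<and> bounded_linear H"

definition dual_space :: "(complex \<Rightarrow> 'a::banach \<Rightarrow> 'a) \<Rightarrow> ('a \<Rightarrow> complex) set"
  where "dual_space s = {\<phi>. Vector_Spaces.linear s (*) \<phi> \<and> bounded_linear \<phi>}"

definition operator_spectrum :: "(complex \<Rightarrow> 'a::banach \<Rightarrow> 'a) \<Rightarrow> ('a \<Rightarrow> 'a) \<Rightarrow> complex set"
  where "operator_spectrum s H =
    {c. \<not> (\<exists>R. bounded_operator s R \<and> (\<forall>x. R (H x - s c x) = x) \<and> (\<forall>x. H (R x) - s c (R x) = x))}"

text \<open>The spatial numerical range; an operator is hermitian (in the sense of Lumer) if it is real.\<close>

definition numerical_range :: "(complex \<Rightarrow> 'a::banach \<Rightarrow> 'a) \<Rightarrow> ('a \<Rightarrow> 'a) \<Rightarrow> complex set"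
  where "numerical_range s H =
    {\<phi> (H x) | \<phi> x. \<phi> \<in> dual_space s \<and> \<phi> x = 1 \<and> norm x = 1 \<and> onorm \<phi> = 1}"

definition hermitian_operator :: "(complex \<Rightarrow> 'a::banach \<Rightarrow> 'a) \<Rightarrow> ('a \<Rightarrow> 'a) \<Rightarrow> bool"
  where "hermitian_operator s H \<longleftrightarrow> bounded_operator s H \<and> numerical_range s H \<subseteq> \<real>"

locale jb_star_triple = complex_banach_space s
  for s :: "complex \<Rightarrow> 'a::banach \<Rightarrow> 'a" +
  fixes tp :: "'a \<Rightarrow> 'a \<Rightarrow> 'a \<Rightarrow> 'a"
  assumes tp_continuous: "continuous_on UNIV (\<lambda>(x, y, z). tp x y z)"
    and tp_symmetric: "tp x y z = tp z y x"
    and tp_linear: "Vector_Spaces.linear s s (\<lambda>x. tp x y z)"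
    and tp_conj_add: "tp x (y + y') z = tp x y z + tp x y' z"
    and tp_conj_scale: "tp x (s k y) z = s (cnj k) (tp x y z)"
    and jordan_identity:
      "tp x y (tp a b c) = tp (tp x y a) b c - tp a (tp y x b) c + tp a b (tp x y c)"
    and L_hermitian: "hermitian_operator s (\<lambda>x. tp a a x)"
    and L_spectrum: "operator_spectrum s (\<lambda>x. tp a a x) \<subseteq> \<real>\<^sub>\<ge>\<^sub>0"
    and L_norm: "onorm (\<lambda>x. tp a a x) = (norm a)\<^sup>2"

definition triple_derivation ::
    "(complex \<Rightarrow> 'a::banach \<Rightarrow> 'a) \<Rightarrow> ('a \<Rightarrow> 'a \<Rightarrow> 'a \<Rightarrow> 'a) \<Rightarrow> ('a \<Rightarrow> 'a) \<Rightarrow> bool"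
  where "triple_derivation s tp \<delta> \<longleftrightarrow> Vector_Spaces.linear s s \<delta> \<and>
    (\<forall>a b c. \<delta> (tp a b c) = tp (\<delta> a) b c + tp a (\<delta> b) c + tp a b (\<delta> c))"

definition weak_local_triple_derivation ::
    "(complex \<Rightarrow> 'a::banach \<Rightarrow> 'a) \<Rightarrow> ('a \<Rightarrow> 'a \<Rightarrow> 'a \<Rightarrow> 'a) \<Rightarrow> ('a \<Rightarrow> 'a) \<Rightarrow> bool"
  where "weak_local_triple_derivation s tp T \<longleftrightarrow> Vector_Spaces.linear s s T \<and>
    (\<forall>\<phi> \<in> dual_space s. \<forall>a. \<exists>\<delta>. triple_derivation s tp \<delta> \<and> \<phi> (T a) = \<phi> (\<delta> a))"

definition dissipative :: "(complex \<Rightarrow> 'a::banach \<Rightarrow> 'a) \<Rightarrow> ('a \<Rightarrow> 'a) \<Rightarrow> bool"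
  where "dissipative s T \<longleftrightarrow> Vector_Spaces.linear s s T \<and>
    (\<forall>\<phi> \<in> dual_space s. \<forall>x. \<phi> x = 1 \<and> norm x = 1 \<and> onorm \<phi> = 1 \<longrightarrow> Re (\<phi> (T x)) \<le> 0)"

end

(*
  Since phi(T x) = phi(d x) for some derivation d, dissipativity only concerns
  derivations. It suffices to find, for a derivation d and a unit vector x, ONE contractive
  functional psi with psi(x) = 1 and Re psi(d x) = 0: this gives |x| <= |x - t d x| for all x and t,
  whence |x + t d x| <= |x| + t^2 |d d x| (apply the first estimate to x + t d x) and so
  Re phi(d x) <= 0 for EVERY phi norming x, although d is not known to be continuous. The same
  estimate for T makes T closable, hence bounded by the closed graph argument.

  To find psi, write x_k = x^(2k+1). If phi norms u, then [a,b] = phi{a,b,u} is a positive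
  semidefinite form, because L(a,a) is hermitian with non-negative spectrum. Since |L(x,x)| = 1,
  Sinclair's theorem yields approximate eigenvectors u of L(x,x) for the eigenvalue 1; the moments
  of the associated states show |x + x_1 + x_2| = 3, so that some phi norming x satisfies
  phi(x_1) = phi(x_2) = 1. Put [a,b] = phi{a,b,x} and psi = [.,x]. For g = x sqrt(1 - x^2), a norm
  convergent odd power series in x, one has {g,g,x} = x_1 - x_2 and [g,g] = 0, so applying phi d to
  {g,g,x} and using the Cauchy-Schwarz inequality gives psi(d x_1) = psi(d x). On the other hand the
  product rule and the Jordan identity give psi(d x_1) = 2 psi(d x) + conj psi(d x),
  and the two together give Re psi(d x) = 0.
*)
theory Submission
  imports Defs "HOL-Complex_Analysis.Complex_Analysis"
begin

section \<open>Norming functionals\<close>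

text \<open>In the Gelfand picture the subtriple generated by \<open>x\<close> consists of functions
  on a subset of [0,1], the odd powers are t, t^3, t^5, and \<open>\<phi>\<close> behaves like
  evaluation at the maximum t = 1. Both \<open>x - tpow x 1\<close> and \<open>g\<close> vanish
  there, so both are null for the form. The representation is never constructed: positivity of the
  form and power associativity stand in for it. The exponents are forced. The product rule yields
  information when an element is written {g,g,x} with \<open>g\<close> null, since both terms
  containing \<open>\<delta> g\<close> then vanish. For x - x_1 this would ask for sqrt(1 - t^2), an
  even function, in general not in the triple; the extra factor t makes it odd and leads to x_1 -
  x_2. Hence the fifth power, and hence a functional with value 1 at three powers at once.
  Sinclair's theorem enters because the axioms give the norm of L(x,x) and the sign of its spectrum,
  but not that 1 is an approximate eigenvalue.\<close>

lemma norming_functional_real: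
  fixes u :: "'a::real_normed_vector"
  shows "\<exists>f. linear f \<and> f u = norm u \<and> (\<forall>y. f y \<le> norm y)"
proof -
  \<comment> \<open>Hahn-Banach by Zorn's lemma on graphs: a partial functional is a subspace of the
    product, dominated by the norm. Domination makes it single-valued, since with (0, a) it also
    contains (0, -a).\<close>
  define A where "A = {G::('a \<times> real) set. subspace G \<and> (u, norm u) \<in> G \<and> (\<forall>(x,a)\<in>G. a \<le> norm x)}"
  have A_I: "G \<in> A" if "subspace G" "(u, norm u) \<in> G" "\<And>x a. (x,a) \<in> G \<Longrightarrow> a \<le> norm x" for G
    using that by (auto simp: A_def)
  have A_D: "subspace G" "(u, norm u) \<in> G" "\<And>x a. (x,a) \<in> G \<Longrightarrow> a \<le> norm x" if "G \<in> A" for G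
    using that by (auto simp: A_def)
  have "range (\<lambda>t. t *\<^sub>R (u, norm u)) \<in> A"
  proof (rule A_I)
    have "range (\<lambda>t. t *\<^sub>R (u, norm u)) = span {(u, norm u)}"
      by (simp only: span_singleton)
    then show "subspace (range (\<lambda>t. t *\<^sub>R (u, norm u)))" by simp
    show "(u, norm u) \<in> range (\<lambda>t. t *\<^sub>R (u, norm u))" by (rule image_eqI[of _ _ 1]) auto
    fix x a assume "(x, a) \<in> range (\<lambda>t. t *\<^sub>R (u, norm u))"
    then obtain t where "x = t *\<^sub>R u" "a = t * norm u" by auto
    then show "a \<le> norm x" by (simp add: mult_right_mono)
  qed
  then have ne: "A \<noteq> {}" by blast
  have chain: "\<Union>C \<in> A" if C: "C \<noteq> {}" "subset.chain A C" for C
  proof (rule A_I)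
    have CA: "G \<in> A" if "G \<in> C" for G using C that by (auto simp: subset.chain_def)
    have tot: "G \<subseteq> G' \<or> G' \<subseteq> G" if "G \<in> C" "G' \<in> C" for G G'
      using C that by (auto simp: subset.chain_def)
    obtain G0 where G0: "G0 \<in> C" using C by blast
    show "subspace (\<Union>C)"
    proof (rule subspaceI)
      show "0 \<in> \<Union>C" using A_D(1)[OF CA[OF G0]] G0 subspace_0 by blast
    next
      fix p q assume "p \<in> \<Union>C" "q \<in> \<Union>C"
      then obtain G G' where *: "G \<in> C" "G' \<in> C" "p \<in> G" "q \<in> G'" by blast
      then obtain H where "H \<in> C" "p \<in> H" "q \<in> H" using tot[of G G'] by blast
      then show "p + q \<in> \<Union>C" using A_D(1)[OF CA] subspace_add by blast
    next
      fix c :: real and p assume "p \<in> \<Union>C"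
      then show "c *\<^sub>R p \<in> \<Union>C" using A_D(1)[OF CA] subspace_scale by blast
    qed
    show "(u, norm u) \<in> \<Union>C" using A_D(2)[OF CA[OF G0]] G0 by blast
    show "a \<le> norm x" if "(x, a) \<in> \<Union>C" for x a using A_D(3)[OF CA] that by blast
  qed
  obtain M where M: "M \<in> A" and Mmax: "\<And>X. X \<in> A \<Longrightarrow> M \<subseteq> X \<Longrightarrow> X = M"
    using subset_Zorn_nonempty[OF ne chain] by blast
  note subM = A_D(1)[OF M] and uM = A_D(2)[OF M] and leM = A_D(3)[OF M]
  have addM: "(x + y, a + b) \<in> M" if "(x,a) \<in> M" "(y,b) \<in> M" for x y a b
    using subspace_add[OF subM that] by simp
  have scaleM: "(c *\<^sub>R x, c * a) \<in> M" if "(x,a) \<in> M" for x a c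
    using subspace_scale[OF subM that, of c] by simp
  have total: "\<exists>a. (x0, a) \<in> M" for x0
  proof -
    define S where "S = (\<lambda>(x,a). a - norm (x - x0)) ` M"
    have cross: "a - norm (x - x0) \<le> norm (y + x0) - b" if "(x,a) \<in> M" "(y,b) \<in> M" for x y a b
    proof -
      have "a + b \<le> norm (x + y)" using leM[OF addM[OF that]] .
      also have "\<dots> \<le> norm (x - x0) + norm (y + x0)"
        using norm_triangle_ineq[of "x - x0" "y + x0"] by simp
      finally show ?thesis by simp
    qed
    have Sne: "S \<noteq> {}" using uM by (auto simp: S_def)
    have Sbd: "bdd_above S"
      unfolding S_def by (rule bdd_aboveI[of _ "norm (u + x0) - norm u"]) (use cross[OF _ uM] in auto)
    \<comment> \<open>The value to be assigned to \<open>x0\<close>. Domination of the extension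
      amounts to \<open>c1\<close> and \<open>c2\<close>, one for each sign of the multiple of
      \<open>x0\<close>; \<open>cross\<close> makes them compatible.\<close>
    define c where "c = Sup S"
    have c1: "a - norm (x - x0) \<le> c" if "(x,a) \<in> M" for x a
      unfolding c_def by (rule cSup_upper[OF _ Sbd]) (use that in \<open>force simp: S_def\<close>)
    have c2: "c \<le> norm (y + x0) - b" if "(y,b) \<in> M" for y b
      unfolding c_def by (rule cSup_least[OF Sne]) (use that cross in \<open>auto simp: S_def\<close>)
    define N where "N = {p + q | p q. p \<in> M \<and> q \<in> span {(x0, c)}}"
    have "N \<in> A"
    proof (rule A_I)
      show "subspace N" unfolding N_def by (rule subspace_sums[OF subM]) simp
      have "(u, norm u) + 0 \<in> N" unfolding N_def using uM span_zero by blast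
      then show "(u, norm u) \<in> N" by simp
      fix x a assume "(x, a) \<in> N"
      then obtain y b t where yb: "(y,b) \<in> M" and xa: "x = y + t *\<^sub>R x0" "a = b + t * c"
        by (auto simp: N_def span_singleton)
      consider "t = 0" | "t > 0" | "t < 0" by linarith
      then show "a \<le> norm x"
      proof cases
        case 1 then show ?thesis using leM[OF yb] xa by simp
      next
        case 2
        have "t * c \<le> t * (norm ((1/t) *\<^sub>R y + x0) - (1/t) * b)"
          using c2[OF scaleM[OF yb, of "1/t"]] 2 by (intro mult_left_mono) auto
        also have "\<dots> = norm (t *\<^sub>R ((1/t) *\<^sub>R y + x0)) - b"
          using 2 by (simp add: right_diff_distrib)
        also have "t *\<^sub>R ((1/t) *\<^sub>R y + x0) = x" using 2 xa by (simp add: scaleR_right_distrib)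
        finally show ?thesis using xa by simp
      next
        case 3
        define r where "r = - t"
        have r: "r > 0" "t = - r" using 3 by (auto simp: r_def)
        have "r * ((1/r) * b - norm ((1/r) *\<^sub>R y - x0)) \<le> r * c"
          using c1[OF scaleM[OF yb, of "1/r"]] r by (intro mult_left_mono) auto
        moreover have "r * norm ((1/r) *\<^sub>R y - x0) = norm (r *\<^sub>R ((1/r) *\<^sub>R y - x0))"
          using r by simp
        moreover have "r *\<^sub>R ((1/r) *\<^sub>R y - x0) = x" using r xa by (simp add: scaleR_right_diff_distrib)
        ultimately show ?thesis using xa r by (simp add: right_diff_distrib)
      qed
    qed
    moreover have "M \<subseteq> N"
    proof
      fix p assume "p \<in> M"
      then have "p + 0 \<in> N" unfolding N_def using span_zero by blast
      then show "p \<in> N" by simp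
    qed
    ultimately have "N = M" using Mmax by blast
    moreover have "0 + (x0, c) \<in> N" unfolding N_def
      using subspace_0[OF subM] span_base[of "(x0,c)" "{(x0,c)}"] by blast
    ultimately show ?thesis by auto
  qed
  have uniq: "a = b" if "(x,a) \<in> M" "(x,b) \<in> M" for x a b
  proof -
    have *: "a \<le> b" if "(x,a) \<in> M" "(x,b) \<in> M" for a b
      using leM[OF addM[OF that(1) scaleM[OF that(2), of "-1"]]] by simp
    show ?thesis using *[OF that] *[OF that(2,1)] by simp
  qed
  define f where "f x = (THE a. (x,a) \<in> M)" for x
  have fM: "(x, f x) \<in> M" for x
    using total[of x] uniq unfolding f_def by (metis (mono_tags, lifting) theI)
  have f_eq: "f x = a" if "(x,a) \<in> M" for x a using uniq[OF fM that] .
  have "linear f"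
    by (rule linearI) (auto intro!: f_eq addM scaleM fM)
  moreover have "f u = norm u" by (rule f_eq[OF uM])
  moreover have "f y \<le> norm y" for y by (rule leM[OF fM])
  ultimately show ?thesis by blast
qed

context complex_banach_space
begin

text \<open>Contractivity in place of norm one admits x = 0 as well; for a unit vector
  \<open>x\<close> the norm is then 1 automatically.\<close>

definition supports :: "('a \<Rightarrow> complex) \<Rightarrow> 'a \<Rightarrow> bool"
  where "supports \<phi> x \<longleftrightarrow> \<phi> \<in> dual_space s \<and> (\<forall>y. cmod (\<phi> y) \<le> norm y) \<and> \<phi> x = of_real (norm x)"

lemma scaleR_eq: "r *\<^sub>R x = s (complex_of_real r) x"
  by (simp add: scale_of_real)

lemma linear_iff_s: "Vector_Spaces.linear s s f \<longleftrightarrow> (\<forall>x y. f (x + y) = f x + f y) \<and> (\<forall>c x. f (s c x) = s c (f x))"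
  by (auto simp: Vector_Spaces.linear_iff vector_space_axioms)

lemma vector_space_complex: "vector_space ((*) :: complex \<Rightarrow> complex \<Rightarrow> complex)"
  by unfold_locales (auto simp: algebra_simps)

lemma functional_linear_iff:
  "Vector_Spaces.linear s (*) f \<longleftrightarrow> (\<forall>x y. f (x + y) = f x + f y) \<and> (\<forall>c x. f (s c x) = c * f x)"
  by (auto simp: Vector_Spaces.linear_iff vector_space_axioms vector_space_complex)

lemma linear_real:
  assumes "Vector_Spaces.linear s s f" shows "linear f"
  using assms unfolding linear_iff_s by (intro linearI) (auto simp: scaleR_eq)

lemma dual_space_I:
  assumes "\<And>x y. \<phi> (x + y) = \<phi> x + \<phi> y" "\<And>c x. \<phi> (s c x) = c * \<phi> x" "\<And>x. cmod (\<phi> x) \<le> norm x * K"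
  shows "\<phi> \<in> dual_space s"
proof -
  have "bounded_linear \<phi>"
    by (rule bounded_linear_intro[of _ K]) (use assms in \<open>auto simp: scaleR_eq scaleR_conv_of_real simp flip: scale_of_real\<close>)
  then show ?thesis using assms by (auto simp: dual_space_def functional_linear_iff)
qed

lemma dual_space_D:
  assumes "\<phi> \<in> dual_space s"
  shows "\<phi> (x + y) = \<phi> x + \<phi> y" "\<phi> (s c x) = c * \<phi> x" "\<phi> (x - y) = \<phi> x - \<phi> y" "\<phi> 0 = 0"
    "\<phi> (r *\<^sub>R x) = of_real r * \<phi> x" "bounded_linear \<phi>" "\<phi> (- x) = - \<phi> x"
proof -
  show bl: "bounded_linear \<phi>" using assms by (auto simp: dual_space_def)
  show "\<phi> (x + y) = \<phi> x + \<phi> y" "\<phi> (x - y) = \<phi> x - \<phi> y" "\<phi> 0 = 0" "\<phi> (- x) = - \<phi> x"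
    using bl by (simp_all add: linear_simps)
  show *: "\<phi> (s c x) = c * \<phi> x" for c x using assms by (auto simp: dual_space_def functional_linear_iff)
  show "\<phi> (r *\<^sub>R x) = of_real r * \<phi> x" by (simp add: scaleR_eq *)
qed

lemma supports_exists: "\<exists>\<phi>. supports \<phi> u"
proof -
  obtain f where f: "linear f" "f u = norm u" "\<And>y. f y \<le> norm y"
    using norming_functional_real[of u] by blast
  note lin = linear_add[OF f(1)] linear_scale[OF f(1)] linear_diff[OF f(1)]
  \<comment> \<open>The unique complex linear functional with real part \<open>f\<close>.\<close>
  define \<phi> where "\<phi> y = Complex (f y) (- f (s \<i> y))" for y
  have add: "\<phi> (x + y) = \<phi> x + \<phi> y" for x y by (simp add: \<phi>_def scale_right_distrib lin complex_eq_iff)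
  have scale: "\<phi> (s c x) = c * \<phi> x" for c x
  proof -
    have e: "s c y = Re c *\<^sub>R y + Im c *\<^sub>R s \<i> y" for y
    proof -
      have "s c y = s (of_real (Re c) + of_real (Im c) * \<i>) y"
        by (rule arg_cong[of _ _ "\<lambda>c. s c y"]) (simp add: complex_eq_iff)
      also have "\<dots> = Re c *\<^sub>R y + Im c *\<^sub>R s \<i> y"
        by (simp only: scale_left_distrib scale_of_real flip: scale_scale)
      finally show ?thesis .
    qed
    have "s \<i> (s \<i> x) = - x" by simp
    moreover have "s \<i> (s c x) = s c (s \<i> x)" by (simp add: mult.commute)
    ultimately have "f (s c x) = Re c * f x + Im c * f (s \<i> x)"
      "f (s \<i> (s c x)) = Re c * f (s \<i> x) - Im c * f x"
      by (simp_all only: e[of x] e[of "s \<i> x"] lin) (simp_all add: linear_neg[OF f(1)])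
    then show ?thesis by (simp add: \<phi>_def complex_eq_iff)
  qed
  have bound: "cmod (\<phi> y) \<le> norm y" for y
  proof -
    \<comment> \<open>Rotating \<open>y\<close> by a unimodular \<open>c\<close> makes the value
      real and nonnegative, so the bound for the real part \<open>f\<close> bounds the
      modulus.\<close>
    obtain c where c: "cmod c = 1" "c * \<phi> y = of_real (cmod (\<phi> y))"
    proof (cases "\<phi> y = 0")
      case True then show ?thesis by (intro that[of 1]) auto
    next
      case False
      have "cnj (sgn (\<phi> y)) * \<phi> y = of_real (cmod (\<phi> y))"
        using False by (simp add: sgn_eq complex_norm_square[symmetric] power2_eq_square mult.commute)
      then show ?thesis using False by (intro that[of "cnj (sgn (\<phi> y))"]) (auto simp: norm_sgn)
    qed
    have "cmod (\<phi> y) = Re (\<phi> (s c y))" by (simp add: scale c)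
    also have "\<dots> = f (s c y)" by (simp add: \<phi>_def)
    also have "\<dots> \<le> norm y" using f(3)[of "s c y"] c by (simp add: norm_scale)
    finally show ?thesis .
  qed
  have dual: "\<phi> \<in> dual_space s" by (rule dual_space_I[of _ 1]) (use add scale bound in auto)
  have "Re (\<phi> u) = norm u" by (simp add: \<phi>_def f)
  moreover have "Im (\<phi> u) = 0"
  proof -
    have "(Re (\<phi> u))\<^sup>2 + (Im (\<phi> u))\<^sup>2 \<le> (norm u)\<^sup>2"
      using bound[of u] by (metis cmod_power2 norm_ge_zero power_mono)
    then show ?thesis using \<open>Re (\<phi> u) = norm u\<close> by simp
  qed
  ultimately have "\<phi> u = of_real (norm u)" by (simp add: complex_eq_iff)
  then show ?thesis using dual bound by (auto simp: supports_def)
qed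

lemma supports_onorm:
  assumes "supports \<phi> x" "norm x = 1"
  shows "\<phi> \<in> dual_space s" "\<phi> x = 1" "onorm \<phi> = 1"
proof -
  show d: "\<phi> \<in> dual_space s" "\<phi> x = 1" using assms by (auto simp: supports_def)
  have "onorm \<phi> \<le> 1" using assms by (intro onorm_bound) (auto simp: supports_def)
  moreover have "norm (\<phi> x) \<le> onorm \<phi> * norm x" by (rule onorm[OF dual_space_D(6)[OF d(1)]])
  ultimately show "onorm \<phi> = 1" using d assms by simp
qed

lemma supports_iff_onorm:
  assumes "\<phi> \<in> dual_space s" "\<phi> x = 1" "onorm \<phi> = 1" "norm x = 1"
  shows "supports \<phi> x"
  using assms onorm[OF dual_space_D(6)[OF assms(1)]] by (auto simp: supports_def)

lemma functional_estimate_imp_norm_estimate: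
  assumes T: "Vector_Spaces.linear s s T"
    and ex: "\<And>x. norm x = 1 \<Longrightarrow> \<exists>\<phi>\<in>dual_space s. (\<forall>y. cmod (\<phi> y) \<le> norm y) \<and> \<phi> x = 1 \<and> Re (\<phi> (T x)) \<le> 0"
    and "0 \<le> t"
  shows "norm x \<le> norm (x - t *\<^sub>R T x)"
proof (cases "x = 0")
  case False
  note lin = linear_scale[OF linear_real[OF T]]
  let ?u = "(1 / norm x) *\<^sub>R x"
  have x: "x = norm x *\<^sub>R ?u" using False by simp
  have "norm ?u = 1" using False by simp
  then obtain \<phi> where \<phi>: "\<phi> \<in> dual_space s" "\<And>y. cmod (\<phi> y) \<le> norm y" "\<phi> ?u = 1" "Re (\<phi> (T ?u)) \<le> 0"
    using ex by blast
  have "1 \<le> Re (\<phi> (?u - t *\<^sub>R T ?u))"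
    using \<phi> \<open>0 \<le> t\<close> by (simp add: dual_space_D[OF \<phi>(1)] mult_nonneg_nonpos del: scaleR_scaleR)
  also have "\<dots> \<le> norm (?u - t *\<^sub>R T ?u)" using complex_Re_le_cmod \<phi>(2) order_trans by blast
  finally have "norm x * 1 \<le> norm x * norm (?u - t *\<^sub>R T ?u)" by (intro mult_left_mono) auto
  also have "\<dots> = norm (norm x *\<^sub>R (?u - t *\<^sub>R T ?u))" by simp
  also have "norm x *\<^sub>R (?u - t *\<^sub>R T ?u) = x - t *\<^sub>R T x"
    using False by (simp add: scaleR_right_diff_distrib lin)
  finally show ?thesis by simp
qed simp

end

section \<open>Dissipative operators\<close>

lemma banach_covered_by_closed:
  fixes A :: "nat \<Rightarrow> 'a::banach set"
  assumes closed: "\<And>n. closed (A n)" and cover: "(\<Union>n. A n) = UNIV"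
  shows "\<exists>n x r. 0 < r \<and> ball x r \<subseteq> A n"
proof (rule ccontr)
  assume no: "\<not> ?thesis"
  have "Met_TC.mtopology interior_of \<Union>(range A) = {}"
  proof (rule Met_TC.metric_Baire_category_alt)
    show "Met_TC.mcomplete TYPE('a)" by (simp add: complete_UNIV)
    show "countable (range A)" by simp
    fix T assume "T \<in> range A"
    then obtain n where n: "T = A n" by blast
    have "interior (A n) = {}" using no by (auto simp: mem_interior)
    then show "closedin Met_TC.mtopology T \<and> Met_TC.mtopology interior_of T = {}"
      using closed n by simp
  qed
  then show False using cover by simp
qed

text \<open>No continuity of \<open>T\<close> is needed: apply the hypothesis to \<open>w = x + t *\<^sub>R T x\<close>, for which
  \<open>w - t *\<^sub>R T w = x - t\<^sup>2 *\<^sub>R T (T x)\<close>.\<close>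

lemma dissipative_norm_growth:
  assumes "linear T" and diss: "\<And>x t. 0 \<le> t \<Longrightarrow> norm x \<le> norm (x - t *\<^sub>R T x)" and "0 \<le> t"
  shows "norm (x + t *\<^sub>R T x) \<le> norm x + t\<^sup>2 * norm (T (T x))"
proof -
  have "norm (x + t *\<^sub>R T x) \<le> norm ((x + t *\<^sub>R T x) - t *\<^sub>R T (x + t *\<^sub>R T x))"
    by (rule diss[OF \<open>0 \<le> t\<close>])
  also have "(x + t *\<^sub>R T x) - t *\<^sub>R T (x + t *\<^sub>R T x) = x - t\<^sup>2 *\<^sub>R T (T x)"
    by (simp add: linear_add[OF assms(1)] linear_scale[OF assms(1)] scaleR_right_distrib power2_eq_square)
  also have "norm \<dots> \<le> norm x + t\<^sup>2 * norm (T (T x))"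
    using norm_triangle_ineq4[of x "t\<^sup>2 *\<^sub>R T (T x)"] by simp
  finally show ?thesis .
qed

text \<open>Test the estimate on X n / t + v: the factor t turns the image into T (X n) + t T v, and
  n to infinity gives |v| <= |v - y - t T v|. With v = y only t T y remains on the right, and t
  tends to 0.\<close>

lemma dissipative_estimate_closable:
  fixes T :: "'a::real_normed_vector \<Rightarrow> 'a"
  assumes "linear T" and diss: "\<And>x t. 0 \<le> t \<Longrightarrow> norm x \<le> norm (x - t *\<^sub>R T x)"
    and X: "X \<longlonglongrightarrow> 0" and TX: "(\<lambda>n. T (X n)) \<longlonglongrightarrow> y"
  shows "y = 0"
proof -
  note lin = linear_add[OF assms(1)] linear_scale[OF assms(1)] linear_diff[OF assms(1)]
  have *: "norm v \<le> norm (v - y - t *\<^sub>R T v)" if "0 < t" for t v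
  proof -
    have "(\<lambda>n. norm ((1/t) *\<^sub>R X n + v)) \<longlonglongrightarrow> norm ((1/t) *\<^sub>R 0 + v)"
      by (intro tendsto_intros X)
    moreover have "(\<lambda>n. norm ((1/t) *\<^sub>R X n + v - (T (X n) + t *\<^sub>R T v)))
        \<longlonglongrightarrow> norm ((1/t) *\<^sub>R 0 + v - (y + t *\<^sub>R T v))"
      by (intro tendsto_intros X TX)
    moreover have "norm ((1/t) *\<^sub>R X n + v) \<le> norm ((1/t) *\<^sub>R X n + v - (T (X n) + t *\<^sub>R T v))" for n
      using diss[of t "(1/t) *\<^sub>R X n + v"] that by (simp add: lin scaleR_right_distrib)
    ultimately have "norm ((1/t) *\<^sub>R 0 + v) \<le> norm ((1/t) *\<^sub>R 0 + v - (y + t *\<^sub>R T v))"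
      by (intro LIMSEQ_le) auto
    then show ?thesis by (simp add: algebra_simps)
  qed
  have "((\<lambda>t. norm (y - y - t *\<^sub>R T y)) \<longlongrightarrow> norm (y - y - 0 *\<^sub>R T y)) (at_right 0)"
    by (intro tendsto_intros)
  moreover have "eventually (\<lambda>t. norm y \<le> norm (y - y - t *\<^sub>R T y)) (at_right 0)"
    by (rule eventually_at_rightI[of 0 1]) (use *[of _ y] in auto)
  ultimately have "norm y \<le> norm (y - y - 0 *\<^sub>R T y)"
    by (intro tendsto_lowerbound) auto
  then show ?thesis by simp
qed

text \<open>Closed graph theorem. By Baire, vectors with bounded image are dense in some ball;
  successive approximation, halving the error each time, writes \<open>y\<close> as a series whose
  images are summable.\<close>

lemma closable_imp_bounded_linear:
  fixes T :: "'a::banach \<Rightarrow> 'b::banach"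
  assumes "linear T" and closable: "\<And>X y. X \<longlonglongrightarrow> 0 \<Longrightarrow> (\<lambda>n. T (X n)) \<longlonglongrightarrow> y \<Longrightarrow> y = 0"
  shows "bounded_linear T"
proof -
  note lin = linear_add[OF assms(1)] linear_scale[OF assms(1)] linear_diff[OF assms(1)] linear_0[OF assms(1)]
  define A where "A n = closure {x. norm (T x) \<le> real n}" for n :: nat
  have "x \<in> (\<Union>n. A n)" for x
  proof -
    obtain n where "norm (T x) \<le> real n" using real_arch_simple by blast
    then have "x \<in> A n" unfolding A_def by (intro subsetD[OF closure_subset]) simp
    then show ?thesis by blast
  qed
  then have "(\<Union>n. A n) = UNIV" by blast
  then obtain n x0 r where r: "0 < r" and ball: "ball x0 r \<subseteq> A n"
    using banach_covered_by_closed[of A] unfolding A_def by (metis closed_closure)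
  have near: "\<exists>z. norm (y - z) < e \<and> norm (T z) \<le> real n" if y: "norm y < r" and e: "0 < e" for y e
  proof -
    have "x0 + y \<in> A n" "x0 - y \<in> A n" using ball y by (auto simp: subset_iff dist_norm)
    then obtain a b where a: "norm (T a) \<le> real n" "norm (a - (x0 + y)) < e"
      and b: "norm (T b) \<le> real n" "norm (b - (x0 - y)) < e"
      unfolding A_def closure_approachable dist_norm using e by blast
    \<comment> \<open>Half the difference removes the unknown centre: \<open>a\<close> is near x0 +
      y and \<open>b\<close> is near x0 - y.\<close>
    let ?z = "(1/2) *\<^sub>R (a - b)"
    have "y - ?z = (1/2) *\<^sub>R ((b - (x0 - y)) - (a - (x0 + y)))"
      by (simp add: algebra_simps flip: scaleR_left_distrib)
    then have "norm (y - ?z) = (1/2) * norm ((b - (x0 - y)) - (a - (x0 + y)))"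
      by (simp only: norm_scaleR)
    also have "\<dots> \<le> (1/2) * (norm (b - (x0 - y)) + norm (a - (x0 + y)))"
      by (intro mult_left_mono norm_triangle_ineq4) simp
    finally have "norm (y - ?z) \<le> (1/2) * (norm (b - (x0 - y)) + norm (a - (x0 + y)))" .
    moreover have "norm (T ?z) \<le> (1/2) * (norm (T a) + norm (T b))"
      using norm_triangle_ineq4[of "T a" "T b"] by (simp add: lin)
    ultimately show ?thesis using a b by (intro exI[of _ ?z]) auto
  qed
  define K where "K = 2 * real n / r"
  have near': "\<exists>z. norm (y - z) \<le> norm y / 2 \<and> norm (T z) \<le> K * norm y" for y
  proof (cases "y = 0")
    case True then show ?thesis by (intro exI[of _ 0]) (simp add: lin)
  next
    case False
    define c where "c = r / (2 * norm y)"
    have c: "c > 0" using False r by (simp add: c_def)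
    have "norm (c *\<^sub>R y) < r" using c r False by (simp add: c_def)
    then obtain z where z: "norm (c *\<^sub>R y - z) < c * norm y / 2" "norm (T z) \<le> real n"
      using near[of "c *\<^sub>R y" "c * norm y / 2"] c False by auto
    let ?w = "(1/c) *\<^sub>R z"
    have "c * norm (y - ?w) = norm (c *\<^sub>R (y - ?w))" using c by simp
    also have "c *\<^sub>R (y - ?w) = c *\<^sub>R y - z" using c by (simp add: scaleR_right_diff_distrib)
    finally have "c * norm (y - ?w) \<le> c * (norm y / 2)" using z by simp
    then have "norm (y - ?w) \<le> norm y / 2" using c by simp
    moreover have "norm (T ?w) \<le> K * norm y"
      using z c False r by (simp add: lin K_def c_def field_simps)
    ultimately show ?thesis by blast
  qed
  then obtain Z where Z1: "norm (y - Z y) \<le> norm y / 2" and Z2: "norm (T (Z y)) \<le> K * norm y" for y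
    by metis
  have "norm (T y) \<le> norm y * (2 * K)" for y
  proof -
    define Y where "Y = rec_nat y (\<lambda>_ w. w - Z w)"
    have Y0: "Y 0 = y" and YS: "Y (Suc k) = Y k - Z (Y k)" for k by (auto simp: Y_def)
    have Yn: "norm (Y k) \<le> norm y * (1/2)^k" for k
    proof (induction k)
      case (Suc k) then show ?case using Z1[of "Y k"] by (simp add: YS)
    qed (simp add: Y0)
    have K0: "K \<ge> 0" using r by (simp add: K_def)
    have TZ: "norm (T (Z (Y k))) \<le> K * norm y * (1/2)^k" for k
      using Z2[of "Y k"] mult_left_mono[OF Yn[of k] K0] by (simp add: mult.assoc)
    have gs: "(\<lambda>k. K * norm y * (1/2)^k) sums (K * norm y * 2)"
      using sums_mult[OF geometric_sums[of "1/2::real"], of "K * norm y"] by simp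
    have summ: "summable (\<lambda>k. T (Z (Y k)))"
      by (rule summable_comparison_test[OF _ sums_summable[OF gs]]) (use TZ in blast)
    have part: "(\<Sum>k<m. T (Z (Y k))) = T (y - Y m)" for m
    proof (induction m)
      case 0 then show ?case by (simp add: Y0 lin)
    next
      case (Suc m) then show ?case by (simp add: YS lin)
    qed
    have Ylim: "Y \<longlonglongrightarrow> 0"
    proof (rule Lim_null_comparison)
      show "\<forall>\<^sub>F k in sequentially. norm (Y k) \<le> norm y * (1/2)^k" using Yn by simp
      show "(\<lambda>k. norm y * (1/2)^k) \<longlonglongrightarrow> 0" by (intro tendsto_mult_right_zero LIMSEQ_power_zero) simp
    qed
    have "(\<lambda>m. T (y - Y m)) \<longlonglongrightarrow> (\<Sum>k. T (Z (Y k)))"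
      using summable_LIMSEQ[OF summ] by (simp add: part)
    then have "(\<lambda>m. T y - T (y - Y m)) \<longlonglongrightarrow> T y - (\<Sum>k. T (Z (Y k)))"
      by (intro tendsto_intros)
    then have "(\<lambda>m. T (Y m)) \<longlonglongrightarrow> T y - (\<Sum>k. T (Z (Y k)))" by (simp add: lin)
    \<comment> \<open>The remainders \<open>Y m\<close> tend to 0 and their images converge, so
      closability forces that limit to be 0.\<close>
    from closable[OF Ylim this] have "T y = (\<Sum>k. T (Z (Y k)))" by simp
    also have "norm \<dots> \<le> (\<Sum>k. K * norm y * (1/2)^k)"
      by (rule norm_suminf_le[OF _ sums_summable[OF gs]]) (rule TZ)
    also have "\<dots> = norm y * (2 * K)" using sums_unique[OF gs] by (simp only: mult_ac)
    finally show ?thesis .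
  qed
  then show ?thesis by (intro bounded_linear_intro[of _ "2 * K"]) (auto simp: lin)
qed

lemma dissipative_estimate_bounded_linear:
  fixes T :: "'a::banach \<Rightarrow> 'a"
  assumes "linear T" and "\<And>x t. 0 \<le> t \<Longrightarrow> norm x \<le> norm (x - t *\<^sub>R T x)"
  shows "bounded_linear T"
  by (rule closable_imp_bounded_linear[OF assms(1) dissipative_estimate_closable[OF assms]])

section \<open>Bernstein's inequality\<close>

lemma contour_integral_rectpath_bound:
  assumes cont: "continuous_on (path_image (rectpath a b)) f" and "0 \<le> B"
    and B: "\<And>z. z \<in> path_image (rectpath a b) \<Longrightarrow> norm (f z) \<le> B"
    and "Re a \<le> Re b" "Im a \<le> Im b"
  shows "norm (contour_integral (rectpath a b) f) \<le> B * (2 * (Re b - Re a) + 2 * (Im b - Im a))"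
proof -
  define c d where "c = Complex (Re b) (Im a)" and "d = Complex (Re a) (Im b)"
  have rp: "rectpath a b = linepath a c +++ linepath c b +++ linepath b d +++ linepath d a"
    by (simp add: rectpath_def Let_def c_def d_def)
  have img: "path_image (rectpath a b) =
      closed_segment a c \<union> (closed_segment c b \<union> (closed_segment b d \<union> closed_segment d a))"
    by (simp add: rp path_image_join)
  have ci: "f contour_integrable_on linepath p q" if "closed_segment p q \<subseteq> path_image (rectpath a b)" for p q
    by (intro contour_integrable_continuous_linepath continuous_on_subset[OF cont] that)
  have bd: "norm (contour_integral (linepath p q) f) \<le> B * norm (q - p)"
    if "closed_segment p q \<subseteq> path_image (rectpath a b)" for p q
    by (intro contour_integral_bound_linepath ci that \<open>0 \<le> B\<close> B) (use that in blast)
  have seg: "closed_segment a c \<subseteq> path_image (rectpath a b)" "closed_segment c b \<subseteq> path_image (rectpath a b)"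
    "closed_segment b d \<subseteq> path_image (rectpath a b)" "closed_segment d a \<subseteq> path_image (rectpath a b)"
    unfolding img by blast+
  note ci' = seg[THEN ci] and bd' = seg[THEN bd]
  have "contour_integral (rectpath a b) f = contour_integral (linepath a c) f + contour_integral (linepath c b) f
      + contour_integral (linepath b d) f + contour_integral (linepath d a) f"
    unfolding rp by (simp add: ci' contour_integrable_join valid_path_join)
  moreover have "norm (c - a) = Re b - Re a" "norm (b - c) = Im b - Im a"
    "norm (d - b) = Re b - Re a" "norm (a - d) = Im b - Im a"
    using assms by (simp_all add: c_def d_def cmod_def)
  moreover have "norm (p + q + r + t) \<le> norm p + norm q + norm r + norm t" for p q r t :: complex
    by (intro order_trans[OF norm_triangle_ineq] add_right_mono) auto
  ultimately show ?thesis using bd' by (smt (verit) distrib_left)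
qed

text \<open>The squared modulus is cos^2 (Re z) + sinh^2 (Im z). On the vertical lines the cosine
  term is 1, which gives cosh; on the horizontal lines |Im z| is at least pi, so sinh alone is large
  enough. The constant 1/4 is generous.\<close>

lemma cmod_cos_square_lower_bound:
  fixes n :: nat
  assumes "1 \<le> n" and "\<bar>Re z\<bar> = real n * pi \<or> \<bar>Im z\<bar> = real n * pi"
  shows "exp \<bar>Im z\<bar> / 4 \<le> cmod (cos z)"
proof -
  define a where "a = \<bar>Im z\<bar>"
  have eq: "(exp (Im z) - inverse (exp (Im z)))\<^sup>2 = (exp a - exp (- a))\<^sup>2"
    by (cases "Im z \<ge> 0") (auto simp: a_def exp_minus power2_commute)
  have e: "exp (-a) * exp a = 1" "exp (-a) > 0" "exp (-a) \<le> 1" "exp a \<ge> 1"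
    by (auto simp: a_def simp flip: exp_add)
  have "(exp a / 4)\<^sup>2 \<le> (cmod (cos z))\<^sup>2"
    using assms(2)
  proof
    assume "\<bar>Re z\<bar> = real n * pi"
    then have "cos (Re z) = cos (real n * pi)" by (metis cos_abs_real)
    then have "(cos (Re z))\<^sup>2 = 1" by (simp add: minus_one_power_iff)
    then have "(cmod (cos z))\<^sup>2 = ((exp a + exp (-a)) / 2)\<^sup>2"
      unfolding norm_cos_squared eq using e(1) by (simp add: power2_eq_square field_simps)
    also have "\<dots> \<ge> (exp a / 4)\<^sup>2" using e by (intro power_mono) auto
    finally show ?thesis .
  next
    assume im: "\<bar>Im z\<bar> = real n * pi"
    have "pi \<le> a" unfolding a_def im using assms(1) by simp
    then have "1 \<le> a" using pi_gt3 by linarith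
    then have "2 \<le> exp a" using exp_ge_add_one_self[of a] by linarith
    moreover have "exp (-a) * 2 \<le> 1 * 2" by (intro mult_right_mono e(3)) simp
    ultimately have "exp (-a) * 2 \<le> exp a" by (simp only: mult_1)
    then have "(exp a - exp (-a)) / 2 \<ge> exp a / 4" by (simp add: field_simps)
    then have "(exp a / 4)\<^sup>2 \<le> ((exp a - exp (-a)) / 2)\<^sup>2" using e by (intro power_mono) auto
    also have "\<dots> \<le> (cmod (cos z))\<^sup>2" unfolding norm_cos_squared eq by (simp add: power_divide)
    finally show ?thesis .
  qed
  then show ?thesis unfolding a_def by (rule power2_le_imp_le) simp
qed

lemma cmod_sin_le_exp: "cmod (sin z) \<le> exp \<bar>Im z\<bar>"
proof -
  have "cmod (sin z) = cmod (exp (\<i> * z) - exp (- (\<i> * z))) / 2"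
    by (simp add: sin_exp_eq norm_divide norm_mult)
  also have "\<dots> \<le> (cmod (exp (\<i> * z)) + cmod (exp (- (\<i> * z)))) / 2"
    by (intro divide_right_mono norm_triangle_ineq4) auto
  also have "\<dots> \<le> (exp \<bar>Im z\<bar> + exp \<bar>Im z\<bar>) / 2"
    by (intro divide_right_mono add_mono) (auto simp: norm_exp_eq_Re)
  finally show ?thesis by simp
qed

text \<open>These are the 2n zeros of the cosine between -n pi and n pi. The ends lie midway between
  consecutive zeros, so the contour keeps clear of them.\<close>

definition cos_zeros :: "nat \<Rightarrow> real set"
  where "cos_zeros n = (\<lambda>k::int. (of_int k + 1/2) * pi) ` {- int n..<int n}"

lemma cos_zeros_facts:
  assumes "p \<in> cos_zeros n"
  shows "cos p = 0" "p \<noteq> 0" "\<bar>p\<bar> < real n * pi" "(sin p)\<^sup>2 = 1"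
proof -
  obtain k :: int where k: "- int n \<le> k" "k < int n" "p = (of_int k + 1/2) * pi"
    using assms by (auto simp: cos_zeros_def)
  have "p = of_int (2 * k + 1) * (pi/2)" using k by (simp add: field_simps)
  then show c: "cos p = 0" unfolding cos_zero_iff_int by (metis even_add even_mult_iff odd_one even_numeral)
  have "of_int k + (1/2::real) \<noteq> 0"
  proof
    assume "of_int k + (1/2::real) = 0"
    then have "of_int (2 * k + 1) = (0::real)" by simp
    then have "2 * k + 1 = 0" by (simp only: of_int_eq_0_iff)
    then show False by presburger
  qed
  then show "p \<noteq> 0" using k by simp
  have "\<bar>of_int k + 1/2 :: real\<bar> < real n" using k(1,2) by linarith
  then show "\<bar>p\<bar> < real n * pi" using k(3) by (simp add: abs_mult)
  show "(sin p)\<^sup>2 = 1" using sin_cos_squared_add[of p] c by simp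
qed

text \<open>The slack 1 stays below pi/2, the distance from n pi to the next zero. It leaves room
  for an open set that contains the closed square and no further pole.\<close>

lemma cos_zero_in_cos_zeros:
  fixes z :: complex
  assumes "cos z = 0" "\<bar>Re z\<bar> < real n * pi + 1"
  shows "z \<in> of_real ` cos_zeros n"
proof -
  obtain k :: int where k: "z = of_real (of_int k * pi) + of_real pi / 2"
    using assms(1) unfolding cos_eq_0 by (auto simp: Ints_def)
  then have z: "z = of_real ((of_int k + 1/2) * pi)" by (simp add: algebra_simps)
  have "Re z = (of_int k + 1/2) * pi" unfolding z by (rule Re_complex_of_real)
  then have "\<bar>of_int k + 1/2 :: real\<bar> * pi < real n * pi + 1" using assms(2) by (simp add: abs_mult)
  also have "\<dots> < (real n + 1/2) * pi" using pi_gt3 by (simp add: distrib_right)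
  finally have "\<bar>of_int k + 1/2 :: real\<bar> * pi < (real n + 1/2) * pi" .
  then have "\<bar>of_int k + 1/2 :: real\<bar> < real n + 1/2" by simp
  then have "- int n \<le> k" "k < int n" by linarith+
  then have "(of_int k + 1/2) * pi \<in> cos_zeros n" unfolding cos_zeros_def by (intro image_eqI[of _ _ k]) auto
  then show ?thesis unfolding z by (rule imageI)
qed

text \<open>Integrate \<open>f z / (z\<^sup>2 * cos z)\<close> along the boundary of the square with half side \<open>R\<close>.\<close>

lemma bernstein_interpolation:
  fixes f :: "complex \<Rightarrow> complex" and n :: nat
  assumes holf: "f holomorphic_on UNIV" and n: "1 \<le> n" and R: "R = real n * pi" and "0 \<le> M"
    and bound: "\<And>z. \<bar>Re z\<bar> \<le> R \<Longrightarrow> \<bar>Im z\<bar> \<le> R \<Longrightarrow> cmod (f z) \<le> M * exp \<bar>Im z\<bar>"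
  shows "cmod (deriv f 0 - (\<Sum>p\<in>cos_zeros n. f (of_real p) * of_real (sin p / p\<^sup>2))) \<le> 16 * M / (pi * R)"
proof -
  have Rpos: "R > 0" using n R by simp
  define a b where "a = Complex (- R) (- R)" and "b = Complex R R"
  define S where "S = box (Complex (- (R+1)) (- (R+1))) (Complex (R+1) (R+1))"
  define pts :: "complex set" where "pts = insert 0 (of_real ` cos_zeros n)"
  define F where "F z = f z / (z\<^sup>2 * cos z)" for z
  have finz: "finite (cos_zeros n)" by (simp add: cos_zeros_def)
  have "\<bar>Re z\<bar> < real n * pi + 1" if "z \<in> S" for z
    using that by (simp add: S_def in_box_complex_iff R abs_less_iff)
  then have nz: "z \<noteq> 0" "cos z \<noteq> 0" if "z \<in> S - pts" for z
    using that cos_zero_in_cos_zeros[of z n] by (auto simp: pts_def)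
  have holF: "F holomorphic_on S - pts"
    unfolding F_def by (intro holomorphic_intros holomorphic_on_subset[OF holf]) (use nz in auto)
  have img: "path_image (rectpath a b) = cbox a b - box a b"
    using Rpos by (intro path_image_rectpath_cbox_minus_box) (auto simp: a_def b_def)
  have bdry: "\<bar>Re z\<bar> \<le> R" "\<bar>Im z\<bar> \<le> R" "\<bar>Re z\<bar> = R \<or> \<bar>Im z\<bar> = R" if "z \<in> path_image (rectpath a b)" for z
    using that unfolding img by (auto simp: a_def b_def in_box_complex_iff in_cbox_complex_iff)
  have sub: "path_image (rectpath a b) \<subseteq> S - pts"
  proof
    fix z assume z: "z \<in> path_image (rectpath a b)"
    note bd = bdry[OF z]
    have "z \<in> S" using bd Rpos by (auto simp: S_def in_box_complex_iff)
    moreover have "z \<notin> pts"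
    proof
      assume "z \<in> pts"
      then have "\<bar>Im z\<bar> < R" "\<bar>Re z\<bar> < R" using cos_zeros_facts(3) Rpos by (auto simp: pts_def R)
      then show False using bd by simp
    qed
    ultimately show "z \<in> S - pts" by blast
  qed
  have "contour_integral (rectpath a b) F = 2 * pi * \<i> * (\<Sum>p\<in>pts. winding_number (rectpath a b) p * residue F p)"
  proof (rule Residue_theorem[OF _ _ _ holF])
    show "open S" "connected S" by (auto simp: S_def intro: convex_connected)
    show "finite pts" using finz by (simp add: pts_def)
    show "\<forall>z. z \<notin> S \<longrightarrow> winding_number (rectpath a b) z = 0"
      using Rpos by (auto intro!: winding_number_rectpath_outside simp: a_def b_def S_def in_box_complex_iff in_cbox_complex_iff)
  qed (use sub in auto)
  also have "(\<Sum>p\<in>pts. winding_number (rectpath a b) p * residue F p) = (\<Sum>p\<in>pts. residue F p)"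
  proof (intro sum.cong refl)
    fix p assume p: "p \<in> pts"
    have "- R < x" "x < R" if "x \<in> cos_zeros n" for x
      using cos_zeros_facts(3)[OF that] unfolding R by linarith+
    then have "p \<in> box a b"
      using p Rpos unfolding pts_def in_box_complex_iff a_def b_def by auto
    then show "winding_number (rectpath a b) p * residue F p = residue F p"
      by (simp add: winding_number_rectpath)
  qed
  also have "\<dots> = residue F 0 + (\<Sum>p\<in>cos_zeros n. residue F (of_real p))"
    unfolding pts_def using finz cos_zeros_facts(2) by (subst sum.insert) (auto simp: sum.reindex inj_on_def)
  \<comment> \<open>A double pole: its residue is the derivative of f / cos at 0, where cos is 1 and
    has derivative 0.\<close>
  also have "residue F 0 = deriv f 0"
  proof -
    define A where "A = {z::complex. cos z \<noteq> 0}"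
    have "open A" unfolding A_def by (intro open_Collect_neq continuous_intros)
    have "residue (\<lambda>z. (f z / cos z) / z ^ Suc 1) 0 = (deriv ^^ 1) (\<lambda>z. f z / cos z) 0 / fact 1"
      by (rule residue_holomorphic_over_power'[OF \<open>open A\<close>])
        (auto simp: A_def intro!: holomorphic_intros holomorphic_on_subset[OF holf])
    moreover have "((\<lambda>z. f z / cos z) has_field_derivative (deriv f 0 * cos 0 - f 0 * (- sin 0)) / (cos 0 * cos 0)) (at 0)"
      by (rule DERIV_divide[OF holomorphic_derivI[OF holf] DERIV_cos]) auto
    then have "deriv (\<lambda>z. f z / cos z) 0 = deriv f 0" by (simp add: DERIV_imp_deriv)
    moreover have "F = (\<lambda>z. (f z / cos z) / z ^ Suc 1)" by (auto simp: F_def power2_eq_square fun_eq_iff)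
    ultimately show ?thesis by simp
  qed
  also have "(\<Sum>p\<in>cos_zeros n. residue F (of_real p)) = - (\<Sum>p\<in>cos_zeros n. f (of_real p) * of_real (sin p / p\<^sup>2))"
    unfolding sum_negf[symmetric]
  proof (intro sum.cong refl)
    fix p assume "p \<in> cos_zeros n"
    note p = cos_zeros_facts[OF this]
    let ?z = "complex_of_real p"
    have cz: "cos ?z = 0" using p(1) by (simp add: cos_of_real)
    have sz: "sin ?z = of_real (sin p)" by (simp add: sin_of_real)
    have sne: "sin p \<noteq> 0" using p(4) by auto
    have res: "residue (\<lambda>w. (g w / w\<^sup>2) / cos w) ?z = (g ?z / ?z\<^sup>2) / (- sin ?z)"
      if "g holomorphic_on UNIV" "g ?z \<noteq> 0" for g
    proof (rule residue_simple_pole_deriv[where s = "- {0}"])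
      show "connected (- {0::complex})" by (intro connected_punctured_universe) simp
      show "(\<lambda>w. g w / w\<^sup>2) holomorphic_on - {0}"
        by (intro holomorphic_intros holomorphic_on_subset[OF that(1)]) auto
    qed (use that p cz sz sne in \<open>auto intro!: holomorphic_intros derivative_eq_intros\<close>)
    have "residue (\<lambda>w. (f w / w\<^sup>2) / cos w) ?z = (f ?z / ?z\<^sup>2) / (- sin ?z)"
    proof (cases "f ?z = 0")
      case False then show ?thesis using res[OF holf] by simp
    next
      case True
      \<comment> \<open>The simple pole formula asks for a nonzero numerator. Where \<open>f\<close>
        vanishes it is applied to f + 1 and to 1, and the residues are subtracted.\<close>
      define s where "s = S - (pts - {?z})"
      have "open s" unfolding s_def using finz by (intro open_Diff finite_imp_closed) (auto simp: S_def pts_def)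
      have "?z \<in> s" using p(3) Rpos by (auto simp: s_def S_def in_box_complex_iff R)
      have hol: "(\<lambda>w. (g w / w\<^sup>2) / cos w) holomorphic_on s - {?z}" if "g holomorphic_on UNIV" for g
        by (intro holomorphic_intros holomorphic_on_subset[OF that]) (use nz in \<open>auto simp: s_def\<close>)
      have hol1: "(\<lambda>w. f w + 1) holomorphic_on UNIV" "(\<lambda>w. 1::complex) holomorphic_on UNIV"
        by (intro holomorphic_intros holf)+
      have "residue (\<lambda>w. ((f w + 1) / w\<^sup>2) / cos w - (1 / w\<^sup>2) / cos w) ?z
          = (1 / ?z\<^sup>2) / (- sin ?z) - (1 / ?z\<^sup>2) / (- sin ?z)"
        using residue_diff[OF \<open>open s\<close> \<open>?z \<in> s\<close> hol[OF hol1(1)] hol[OF hol1(2)]] res[OF hol1(1)] res[OF hol1(2)] True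
        by simp
      then show ?thesis using True by (simp add: add_divide_distrib)
    qed
    moreover have "F = (\<lambda>w. (f w / w\<^sup>2) / cos w)" by (simp add: F_def fun_eq_iff)
    ultimately have "residue F ?z = (f ?z / ?z\<^sup>2) / (- of_real (sin p))" using sz by simp
    also have "\<dots> = - (f ?z * of_real (sin p / p\<^sup>2)) * (1 / (of_real (sin p))\<^sup>2)"
      using sne by (simp add: power2_eq_square field_simps)
    also have "(of_real (sin p))\<^sup>2 = (1::complex)" using p(4) by (metis of_real_1 of_real_power)
    finally show "residue F ?z = - (f ?z * of_real (sin p / p\<^sup>2))" by simp
  qed
  finally have eq: "contour_integral (rectpath a b) F = 2 * pi * \<i> *
      (deriv f 0 - (\<Sum>p\<in>cos_zeros n. f (of_real p) * of_real (sin p / p\<^sup>2)))" by simp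
  define D where "D = deriv f 0 - (\<Sum>p\<in>cos_zeros n. f (of_real p) * of_real (sin p / p\<^sup>2))"
  \<comment> \<open>The growth of \<open>f\<close> is cancelled by that of the cosine. What remains
    is 4 M / R^2 on a contour of length 8 R, and division by 2 pi gives 16 M / (pi R).\<close>
  have "norm (contour_integral (rectpath a b) F) \<le> (4 * M / R\<^sup>2) * (2 * (Re b - Re a) + 2 * (Im b - Im a))"
  proof (rule contour_integral_rectpath_bound)
    show "continuous_on (path_image (rectpath a b)) F"
      by (intro holomorphic_on_imp_continuous_on holomorphic_on_subset[OF holF] sub)
    show "0 \<le> 4 * M / R\<^sup>2" using \<open>0 \<le> M\<close> by simp
    fix z assume z: "z \<in> path_image (rectpath a b)"
    note bd = bdry[OF z]
    have "R \<le> cmod z" using bd(3) abs_Re_le_cmod[of z] abs_Im_le_cmod[of z] by auto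
    then have "R\<^sup>2 \<le> cmod (z\<^sup>2)" using Rpos by (simp add: norm_power power_mono)
    moreover have "exp \<bar>Im z\<bar> / 4 \<le> cmod (cos z)"
      using bd(3) by (intro cmod_cos_square_lower_bound[OF n]) (auto simp: R)
    ultimately have "R\<^sup>2 * (exp \<bar>Im z\<bar> / 4) \<le> cmod (z\<^sup>2 * cos z)"
      unfolding norm_mult by (intro mult_mono) auto
    then have "norm (F z) \<le> (M * exp \<bar>Im z\<bar>) / (R\<^sup>2 * (exp \<bar>Im z\<bar> / 4))"
      unfolding F_def norm_divide using bound[OF bd(1,2)] Rpos \<open>0 \<le> M\<close> by (intro frac_le) auto
    then show "norm (F z) \<le> 4 * M / R\<^sup>2" by (simp add: mult.commute)
  qed (use Rpos in \<open>auto simp: a_def b_def\<close>)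
  also have "\<dots> = 32 * M / R" using Rpos by (simp add: a_def b_def power2_eq_square field_simps)
  finally have "cmod (2 * pi * \<i> * D) \<le> 32 * M / R" unfolding eq D_def .
  then have "cmod D \<le> 16 * M / (pi * R)" using Rpos by (simp add: norm_mult field_simps)
  then show ?thesis by (simp add: D_def)
qed

text \<open>The interpolation formula for \<open>sin\<close> itself evaluates the sum of the weights \<open>1 / p\<^sup>2\<close>.\<close>

lemma bernstein_derivative_bound:
  fixes f :: "complex \<Rightarrow> complex" and n :: nat
  assumes holf: "f holomorphic_on UNIV" and n: "1 \<le> n" and R: "R = real n * pi" and M: "0 \<le> M"
    and bound: "\<And>z. \<bar>Re z\<bar> \<le> R \<Longrightarrow> \<bar>Im z\<bar> \<le> R \<Longrightarrow> cmod (f z) \<le> M * exp \<bar>Im z\<bar>"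
  shows "cmod (deriv f 0) \<le> M * (1 + 32 / (pi * R))"
proof -
  let ?S = "\<Sum>p\<in>cos_zeros n. 1 / p\<^sup>2"
  have "deriv sin (0::complex) = 1" using DERIV_imp_deriv[OF DERIV_sin[of "0::complex"]] by simp
  moreover have "(\<Sum>p\<in>cos_zeros n. sin (of_real p) * of_real (sin p / p\<^sup>2)) = complex_of_real ?S"
    unfolding of_real_sum
  proof (intro sum.cong refl)
    fix p assume "p \<in> cos_zeros n"
    then have "(sin p)\<^sup>2 = 1" by (rule cos_zeros_facts)
    then have "sin p * (sin p / p\<^sup>2) = 1 / p\<^sup>2" by (simp add: power2_eq_square)
    then show "sin (of_real p) * of_real (sin p / p\<^sup>2) = complex_of_real (1 / p\<^sup>2)"
      by (metis of_real_mult sin_of_real)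
  qed
  ultimately have "cmod (1 - complex_of_real ?S) \<le> 16 * 1 / (pi * R)"
    using bernstein_interpolation[of sin n R 1] n R cmod_sin_le_exp by (simp add: holomorphic_on_sin)
  then have S: "?S \<le> 1 + 16 / (pi * R)"
    using abs_Re_le_cmod[of "1 - complex_of_real ?S"] by simp
  have "cmod (\<Sum>p\<in>cos_zeros n. f (of_real p) * of_real (sin p / p\<^sup>2)) \<le> (\<Sum>p\<in>cos_zeros n. M * (1 / p\<^sup>2))"
  proof (rule sum_norm_le)
    fix p assume "p \<in> cos_zeros n"
    note p = cos_zeros_facts[OF this]
    have "\<bar>sin p\<bar> = 1" using p(4) by (simp add: abs_square_eq_1)
    then show "cmod (f (of_real p) * of_real (sin p / p\<^sup>2)) \<le> M * (1 / p\<^sup>2)"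
      using bound[of "of_real p"] p(3) R by (simp add: norm_mult norm_divide divide_right_mono norm_power)
  qed
  also have "\<dots> = M * ?S" by (simp add: sum_distrib_left)
  also have "\<dots> \<le> M * (1 + 16 / (pi * R))" using S M by (intro mult_left_mono)
  \<comment> \<open>One error of 16 M / (pi R) comes from the weights, the other from interpolating
    \<open>f\<close>.\<close>
  finally have "cmod (deriv f 0) \<le> M * (1 + 16 / (pi * R)) + 16 * M / (pi * R)"
    using bernstein_interpolation[OF assms] norm_triangle_sub[of "deriv f 0"] by (smt (verit))
  also have "\<dots> = M * (1 + 32 / (pi * R))" by (simp add: distrib_left add_divide_distrib mult.commute)
  finally show ?thesis .
qed

section \<open>Hermitian operators\<close>

context complex_banach_space
begin

lemma bounded_operator_D:
  assumes "bounded_operator s H"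
  shows "H (x + y) = H x + H y" "H (s c x) = s c (H x)" "H (x - y) = H x - H y" "H 0 = 0"
    "H (r *\<^sub>R x) = r *\<^sub>R H x" "bounded_linear H" "H (- x) = - H x"
proof -
  show bl: "bounded_linear H" using assms by (auto simp: bounded_operator_def)
  show "H (x + y) = H x + H y" "H (x - y) = H x - H y" "H 0 = 0" "H (r *\<^sub>R x) = r *\<^sub>R H x" "H (- x) = - H x"
    using bl by (simp_all add: linear_simps)
  show "H (s c x) = s c (H x)" using assms by (auto simp: bounded_operator_def linear_iff_s)
qed

lemma bounded_operatorI:
  assumes "\<And>x y. H (x + y) = H x + H y" "\<And>c x. H (s c x) = s c (H x)" "\<And>x. norm (H x) \<le> norm x * K"
  shows "bounded_operator s H"
proof -
  have "bounded_linear H"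
    by (rule bounded_linear_intro[of _ K]) (use assms in \<open>auto simp: scaleR_eq\<close>)
  then show ?thesis using assms by (auto simp: bounded_operator_def linear_iff_s)
qed

lemma hermitian_operatorD: "hermitian_operator s H \<Longrightarrow> bounded_operator s H"
  by (simp add: hermitian_operator_def)

lemma supports_normalize:
  assumes "supports \<phi> x" "x \<noteq> 0"
  shows "supports \<phi> ((1 / norm x) *\<^sub>R x)"
  using assms by (auto simp: supports_def dual_space_D)

lemma hermitian_supports_real:
  assumes H: "hermitian_operator s H" and \<phi>: "supports \<phi> x"
  shows "\<phi> (H x) \<in> \<real>"
proof (cases "x = 0")
  case True
  then show ?thesis
    using \<phi> bounded_operator_D(4)[OF hermitian_operatorD[OF H]] by (auto simp: supports_def dual_space_D)
next
  case False
  let ?u = "(1 / norm x) *\<^sub>R x"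
  have u: "norm ?u = 1" using False by simp
  note supp = supports_onorm[OF supports_normalize[OF \<phi> False] u]
  have "\<phi> (H ?u) \<in> numerical_range s H" unfolding numerical_range_def using supp u by blast
  then have r: "\<phi> (H ?u) \<in> \<real>" using H by (auto simp: hermitian_operator_def)
  have "\<phi> (H x) = of_real (norm x) * \<phi> (H ?u)"
    using False supp(1) by (simp add: bounded_operator_D(5)[OF hermitian_operatorD[OF H]] dual_space_D)
  then show ?thesis using r by (metis Reals_mult Reals_of_real)
qed

text \<open>For \<open>\<phi>\<close> norming \<open>x\<close> the value \<open>\<phi> (H x)\<close>
  is real, so the imaginary part of the functional's value is due to \<open>c\<close> alone.\<close>

lemma hermitian_imaginary_shift_lower_bound:
  assumes H: "hermitian_operator s H"
  shows "\<bar>Im c\<bar> * norm x \<le> norm (H x + s c x)"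
proof -
  obtain \<phi> where \<phi>: "supports \<phi> x" using supports_exists by blast
  then have d: "\<phi> \<in> dual_space s" "\<And>y. cmod (\<phi> y) \<le> norm y" "\<phi> x = of_real (norm x)" by (auto simp: supports_def)
  have "Im (\<phi> (H x + s c x)) = Im c * norm x"
    using hermitian_supports_real[OF H \<phi>] d by (auto simp: dual_space_D elim: Reals_cases)
  then have "\<bar>Im c\<bar> * norm x \<le> cmod (\<phi> (H x + s c x))"
    using abs_Im_le_cmod[of "\<phi> (H x + s c x)"] by (simp add: abs_mult)
  also have "\<dots> \<le> norm (H x + s c x)" by (rule d)
  finally show ?thesis .
qed

section \<open>Resolvents and positivity of the numerical range\<close>

lemma shift_lower_bound_perturb:
  assumes "m * norm u \<le> norm (H u + s c u)"
  shows "(m - cmod (c' - c)) * norm u \<le> norm (H u + s c' u)"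
proof -
  have "norm (H u + s c u) \<le> norm (H u + s c' u) + norm (s (c' - c) u)"
    using norm_triangle_ineq4[of "H u + s c' u" "s (c' - c) u"] by (simp add: scale_left_diff_distrib)
  then show ?thesis using assms by (simp add: norm_scale left_diff_distrib)
qed

text \<open>Sign convention: the inverse of H + c is the resolvent at -c, so a nonnegative spectrum
  makes H + c invertible for every c in the open right half plane.\<close>

lemma resolvent_exists:
  assumes "- c \<notin> operator_spectrum s H"
  obtains R where "bounded_operator s R" "\<And>x. R (H x + s c x) = x" "\<And>x. H (R x) + s c (R x) = x"
  using assms by (auto simp: operator_spectrum_def)

lemma bounded_below_of_left_inverse:
  assumes R: "bounded_operator s R" and inv: "\<And>x. R (H x + s c x) = x"
  obtains m where "m > 0" "\<And>u. m * norm u \<le> norm (H u + s c u)"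
proof -
  obtain K where K: "K > 0" "\<And>x. norm (R x) \<le> norm x * K"
    using bounded_linear.pos_bounded[OF bounded_operator_D(6)[OF R]] by blast
  have "1 / K * norm u \<le> norm (H u + s c u)" for u
    using K(2)[of "H u + s c u"] K(1) inv by (simp add: field_simps)
  then show ?thesis using that[of "1/K"] K(1) by simp
qed

text \<open>For \<open>R c = (H + e + c)\<^sup>-\<^sup>1\<close> the function \<open>c * \<phi> (R c y)\<close> is holomorphic on the right half plane,
  bounded by \<open>norm y\<close> on the imaginary axis because \<open>H\<close> is hermitian, and asymptotically bounded
  by \<open>norm y\<close> at infinity, so the maximum modulus principle bounds it on the positive real axis.\<close>

lemma hermitian_nonneg_spectrum_imp_norm_estimate:
  assumes H: "hermitian_operator s H" and spec: "\<And>c. c \<in> operator_spectrum s H \<Longrightarrow> 0 \<le> Re c" and "0 \<le> t"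
  shows "norm x \<le> norm (x + t *\<^sub>R H x)"
proof -
  note bH = hermitian_operatorD[OF H]
  note linH = bounded_operator_D[OF bH]
  obtain h where h: "h > 0" "\<And>x. norm (H x) \<le> norm x * h"
    using bounded_linear.pos_bounded[OF linH(6)] by blast
  \<comment> \<open>The shift by \<open>e\<close> puts the closed right half plane inside the domain
    of holomorphy, even if 0 is in the spectrum. It does not change Im c and tends to 0 at the
    end.\<close>
  have main: "l * norm x \<le> norm (H x + s (of_real (l + e)) x)" if "0 < l" "0 < e" for l e x
  proof -
    have "\<exists>R. bounded_operator s R \<and> (\<forall>x. R (H x + s (c + of_real e) x) = x) \<and> (\<forall>x. H (R x) + s (c + of_real e) (R x) = x)"
      if "- e < Re c" for c
    proof -
      have "- (c + of_real e) \<notin> operator_spectrum s H" using spec[of "- (c + of_real e)"] that by auto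
      then show ?thesis by (elim resolvent_exists) blast
    qed
    then obtain R where R: "\<And>c. - e < Re c \<Longrightarrow> bounded_operator s (R c)"
      and R1: "\<And>c x. - e < Re c \<Longrightarrow> R c (H x + s (c + of_real e) x) = x"
      and R2: "\<And>c x. - e < Re c \<Longrightarrow> H (R c x) + s (c + of_real e) (R c x) = x"
      by metis
    define y where "y = H x + s (of_real l + of_real e) x"
    have x: "R (of_real l) y = x" unfolding y_def using R1[of "of_real l" x] that by simp
    obtain \<phi> where \<phi>: "supports \<phi> x" using supports_exists by blast
    then have d: "\<phi> \<in> dual_space s" "\<And>y. cmod (\<phi> y) \<le> norm y" "\<phi> x = of_real (norm x)" by (auto simp: supports_def)
    note lin\<phi> = dual_space_D[OF d(1)]
    define g where "g c = c * \<phi> (R c y)" for c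
    have resolvent_identity: "R c' z - R c z = s (c - c') (R c' (R c z))" if "- e < Re c" "- e < Re c'" for c c' z
    proof -
      have "H (R c z) + s (c' + of_real e) (R c z) + s (c - c') (R c z) = z"
        using R2[OF that(1), of z] by (simp add: scale_left_diff_distrib scale_left_distrib add_ac)
      then have "R c' z = R c' (H (R c z) + s (c' + of_real e) (R c z) + s (c - c') (R c z))" by simp
      also have "\<dots> = R c z + s (c - c') (R c' (R c z))"
        by (simp only: bounded_operator_D(1,2)[OF R[OF that(2)]] R1[OF that(2), unfolded bounded_operator_D(1,2)[OF R[OF that(2)]]])
      finally show ?thesis by simp
    qed
    have R_lim: "((\<lambda>c'. R c' z) \<longlongrightarrow> R c z) (at c)" if c: "- e < Re c" for c z
    proof -
      obtain m where m: "m > 0" "\<And>u. m * norm u \<le> norm (H u + s (c + of_real e) u)"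
        using bounded_below_of_left_inverse[OF R[OF c] R1[OF c]] by blast
      define r where "r = min (m / 2) (Re c + e)"
      have "r > 0" using m c by (simp add: r_def)
      have "norm (R c' z - R c z) \<le> cmod (c' - c) * (2 / m * norm (R c z))" if c': "dist c' c < r" for c'
      proof -
        have 1: "cmod (c' - c) < m / 2" "- e < Re c'"
          using c' abs_Re_le_cmod[of "c' - c"] by (auto simp: r_def dist_norm)
        let ?w = "R c z"
        have "(m - cmod ((c' + of_real e) - (c + of_real e))) * norm (R c' ?w) \<le> norm (H (R c' ?w) + s (c' + of_real e) (R c' ?w))"
          by (rule shift_lower_bound_perturb[OF m(2)])
        then have "(m - cmod (c' - c)) * norm (R c' ?w) \<le> norm ?w" using R2[OF 1(2), of ?w] by simp
        moreover have "m / 2 * norm (R c' ?w) \<le> (m - cmod (c' - c)) * norm (R c' ?w)"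
          using 1 by (intro mult_right_mono) auto
        ultimately have "norm (R c' ?w) \<le> 2 / m * norm ?w" using m(1) by (simp add: field_simps)
        then show ?thesis
          unfolding resolvent_identity[OF c 1(2)] norm_scale by (intro mult_mono) (auto simp: norm_minus_commute)
      qed
      then have "\<forall>\<^sub>F c' in at c. norm (R c' z - R c z) \<le> cmod (c' - c) * (2 / m * norm (R c z))"
        using \<open>r > 0\<close> unfolding eventually_at by blast
      moreover have "((\<lambda>c'. cmod (c' - c) * (2 / m * norm (R c z))) \<longlongrightarrow> cmod (c - c) * (2 / m * norm (R c z))) (at c)"
        by (intro tendsto_intros)
      then have "((\<lambda>c'. cmod (c' - c) * (2 / m * norm (R c z))) \<longlongrightarrow> 0) (at c)" by simp
      ultimately have "((\<lambda>c'. R c' z - R c z) \<longlongrightarrow> 0) (at c)"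
        by (rule Lim_null_comparison)
      then show ?thesis by (simp add: LIM_zero_iff)
    qed
    have deriv: "((\<lambda>c. \<phi> (R c y)) has_field_derivative - \<phi> (R c (R c y))) (at c)" if c: "- e < Re c" for c
    proof -
      have "((\<lambda>c'. - \<phi> (R c' (R c y))) \<longlongrightarrow> - \<phi> (R c (R c y))) (at c)"
        by (intro tendsto_minus bounded_linear.tendsto[OF lin\<phi>(6)] R_lim c)
      moreover have "\<forall>\<^sub>F c' in at c. - \<phi> (R c' (R c y)) = (\<phi> (R c' y) - \<phi> (R c y)) / (c' - c)"
      proof -
        have "open {c'. - e < Re c'}" by (intro open_Collect_less continuous_intros)
        then have "\<forall>\<^sub>F c' in at c. c' \<in> {c'. - e < Re c'}" using c by (intro eventually_at_in_open') auto
        moreover have "\<forall>\<^sub>F c' in at c. c' \<noteq> c" by (simp add: eventually_at_filter)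
        ultimately show ?thesis
        proof eventually_elim
          case (elim c')
          have "\<phi> (R c' y) - \<phi> (R c y) = (c - c') * \<phi> (R c' (R c y))"
            using resolvent_identity[OF c, of c' y] elim by (simp add: lin\<phi>(2) flip: lin\<phi>(3))
          then show ?case using elim by (simp add: field_simps)
        qed
      qed
      ultimately show ?thesis unfolding has_field_derivative_iff by (rule Lim_transform_eventually)
    qed
    have "(\<lambda>c. \<phi> (R c y)) holomorphic_on {c. - e < Re c}"
      unfolding holomorphic_on_def using deriv by (auto simp: field_differentiable_def intro: has_field_derivative_at_within)
    then have holg: "g holomorphic_on {c. - e < Re c}"
      unfolding g_def by (intro holomorphic_on_mult holomorphic_on_ident)
    \<comment> \<open>Maximum modulus on a half disc of radius \<open>\<rho>\<close>. On the
      diameter the hermitian bound applies; on the arc |c + e| exceeds the bound \<open>h\<close> of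
      H by at least \<rho> - (e + h). The resulting factor tends to 1 as \<open>\<rho>\<close>
      grows.\<close>
    have bound: "cmod (g (of_real l)) \<le> \<rho> / (\<rho> - (e + h)) * norm y" if \<rho>: "\<rho> > l" "\<rho> > e + h" for \<rho>
    proof -
      define S where "S = {c. 0 < Re c} \<inter> ball 0 \<rho>"
      have "open S" unfolding S_def by (intro open_Int open_ball open_halfspace_Re_gt)
      have cl: "closure S \<subseteq> {c. 0 \<le> Re c} \<inter> cball 0 \<rho>"
        by (rule closure_minimal) (auto simp: S_def closed_halfspace_Re_ge intro!: closed_Int)
      have sub: "{c. 0 \<le> Re c} \<subseteq> {c. - e < Re c}" using \<open>0 < e\<close> by auto
      show ?thesis
      proof (rule maximum_modulus_frontier[of g S])
        show "g holomorphic_on interior S"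
          using \<open>0 < e\<close> by (intro holomorphic_on_subset[OF holg] order_trans[OF interior_subset]) (auto simp: S_def)
        show "continuous_on (closure S) g"
          using cl sub by (intro holomorphic_on_imp_continuous_on holomorphic_on_subset[OF holg]) auto
        show "bounded S" unfolding S_def by (rule bounded_subset[OF bounded_ball]) auto
        show "complex_of_real l \<in> S" using \<rho> \<open>0 < l\<close> by (simp add: S_def)
        fix c assume "c \<in> frontier S"
        then have "c \<in> closure S" "c \<notin> S" using \<open>open S\<close> by (auto simp: frontier_def interior_open)
        then have c: "0 \<le> Re c" "cmod c \<le> \<rho>" "Re c = 0 \<or> cmod c = \<rho>"
          using cl unfolding S_def by auto
        have ce: "- e < Re c" using c \<open>0 < e\<close> by simp
        have 1: "1 \<le> \<rho> / (\<rho> - (e + h))" using \<rho> \<open>0 < e\<close> h(1) by simp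
        have "cmod (g c) \<le> cmod c * norm (R c y)" by (simp add: g_def norm_mult d(2) mult_left_mono)
        also have "\<dots> \<le> \<rho> / (\<rho> - (e + h)) * norm y"
          using c(3)
        proof
          assume "Re c = 0"
          then have "cmod c = \<bar>Im (c + of_real e)\<bar>" by (simp add: cmod_def)
          then have "cmod c * norm (R c y) \<le> norm y"
            using hermitian_imaginary_shift_lower_bound[OF H, of "c + of_real e" "R c y"] R2[OF ce, of y] by simp
          also have "\<dots> \<le> \<rho> / (\<rho> - (e + h)) * norm y" using mult_right_mono[OF 1, of "norm y"] by simp
          finally show ?thesis .
        next
          assume \<rho>c: "cmod c = \<rho>"
          let ?u = "R c y"
          have "cmod (c + of_real e) \<ge> \<rho> - e"
            using norm_diff_ineq[of c "of_real e"] \<rho>c \<open>0 < e\<close> by simp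
          then have "(\<rho> - e) * norm ?u \<le> norm (s (c + of_real e) ?u)"
            by (simp add: norm_scale mult_right_mono)
          also have "s (c + of_real e) ?u = y - H ?u" using R2[OF ce, of y] by (simp add: eq_diff_eq add.commute)
          also have "norm (y - H ?u) \<le> norm y + norm ?u * h" using norm_triangle_ineq4[of y "H ?u"] h(2)[of ?u] by simp
          finally have "(\<rho> - (e + h)) * norm ?u \<le> norm y" by (simp add: algebra_simps)
          then have "norm ?u \<le> norm y / (\<rho> - (e + h))" using \<rho> by (simp add: pos_le_divide_eq mult.commute)
          then have "\<rho> * norm ?u \<le> \<rho> * (norm y / (\<rho> - (e + h)))"
            using \<rho> \<open>0 < l\<close> by (intro mult_left_mono) auto
          then show ?thesis by (simp add: \<rho>c)
        qed
        finally show "cmod (g c) \<le> \<rho> / (\<rho> - (e + h)) * norm y" .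
      qed
    qed
    have "((\<lambda>\<rho>. \<rho> / (\<rho> - (e + h)) * norm y) \<longlongrightarrow> 1 * norm y) at_top"
      by (intro tendsto_mult tendsto_const) real_asymp
    moreover have "\<forall>\<^sub>F \<rho> in at_top. cmod (g (of_real l)) \<le> \<rho> / (\<rho> - (e + h)) * norm y"
      using eventually_gt_at_top[of l] eventually_gt_at_top[of "e + h"] by eventually_elim (rule bound)
    ultimately have "cmod (g (of_real l)) \<le> 1 * norm y" by (intro tendsto_lowerbound) auto
    moreover have "cmod (g (of_real l)) = l * norm x" using \<open>0 < l\<close> by (simp add: g_def x d norm_mult)
    ultimately show ?thesis using \<open>0 < l\<close> by (simp add: y_def)
  qed
  show ?thesis
  proof (cases "t = 0")
    case False
    then have "t > 0" using \<open>0 \<le> t\<close> by simp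
    have "((\<lambda>e. norm (H x + (1 / t + e) *\<^sub>R x)) \<longlongrightarrow> norm (H x + (1 / t + 0) *\<^sub>R x)) (at_right 0)"
      by (intro tendsto_intros)
    moreover have "\<forall>\<^sub>F e in at_right 0. 1 / t * norm x \<le> norm (H x + (1 / t + e) *\<^sub>R x)"
      by (rule eventually_at_rightI[of 0 1]) (use main[of "1/t"] \<open>t > 0\<close> in \<open>auto simp only: scaleR_eq zero_less_divide_1_iff greaterThanLessThan_iff\<close>)
    ultimately have "1 / t * norm x \<le> norm (H x + (1 / t + 0) *\<^sub>R x)" by (intro tendsto_lowerbound) auto
    then have "t * (1 / t * norm x) \<le> t * norm (H x + (1 / t) *\<^sub>R x)" using \<open>t > 0\<close> by (intro mult_left_mono) auto
    also have "t * norm (H x + (1 / t) *\<^sub>R x) = norm (t *\<^sub>R (H x + (1 / t) *\<^sub>R x))" using \<open>t > 0\<close> by simp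
    also have "t *\<^sub>R (H x + (1 / t) *\<^sub>R x) = x + t *\<^sub>R H x" using \<open>t > 0\<close> by (simp add: scaleR_right_distrib)
    finally show ?thesis using \<open>t > 0\<close> by simp
  qed simp
qed

end

text \<open>Turns a one-step factor 1 / (1 - u) into an exponential with an error of second order,
  which stays controlled when N steps of size 1 / N are multiplied.\<close>

lemma inverse_one_minus_le_exp:
  fixes u :: real
  assumes "0 \<le> u" "u \<le> 1/2"
  shows "1 / (1 - u) \<le> exp (u + 2 * u\<^sup>2)"
proof -
  have "- u - 2 * u\<^sup>2 \<le> ln (1 - u)" using assms by (rule ln_one_minus_pos_lower_bound)
  then have "exp (- (u + 2 * u\<^sup>2)) \<le> 1 - u" using assms by (subst (asm) ln_ge_iff) auto
  then have "1 \<le> (1 - u) * exp (u + 2 * u\<^sup>2)"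
    using mult_right_mono[of _ "1 - u" "exp (u + 2 * u\<^sup>2)"] by (fastforce simp flip: exp_add)
  then show ?thesis using assms by (simp add: pos_divide_le_eq mult.commute)
qed

context complex_banach_space
begin

lemma norm_estimate_imp_functional_estimate:
  assumes "linear T" and diss: "\<And>x t. 0 \<le> t \<Longrightarrow> norm x \<le> norm (x - t *\<^sub>R T x)" and \<phi>: "supports \<phi> x"
  shows "Re (\<phi> (T x)) \<le> 0"
proof -
  have d: "\<phi> \<in> dual_space s" "\<And>y. cmod (\<phi> y) \<le> norm y" "\<phi> x = of_real (norm x)"
    using \<phi> by (auto simp: supports_def)
  have *: "Re (\<phi> (T x)) \<le> t * norm (T (T x))" if "0 < t" for t
  proof -
    have "norm x + t * Re (\<phi> (T x)) = Re (\<phi> (x + t *\<^sub>R T x))" by (simp add: dual_space_D[OF d(1)] d(3))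
    also have "\<dots> \<le> norm (x + t *\<^sub>R T x)" using complex_Re_le_cmod d(2) order_trans by blast
    also have "\<dots> \<le> norm x + t\<^sup>2 * norm (T (T x))"
      using dissipative_norm_growth[OF assms(1) diss] that by simp
    finally have "t * Re (\<phi> (T x)) \<le> t * (t * norm (T (T x)))" by (simp add: power2_eq_square mult.assoc)
    then show ?thesis using that by simp
  qed
  have "((\<lambda>t. t * norm (T (T x))) \<longlongrightarrow> 0 * norm (T (T x))) (at_right 0)" by (intro tendsto_intros)
  moreover have "\<forall>\<^sub>F t in at_right 0. Re (\<phi> (T x)) \<le> t * norm (T (T x))"
    by (rule eventually_at_rightI[of 0 1]) (use * in auto)
  ultimately have "Re (\<phi> (T x)) \<le> 0 * norm (T (T x))" by (intro tendsto_lowerbound) auto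
  then show ?thesis by simp
qed

text \<open>The norm estimate for \<open>H\<close> is the dissipative estimate for -H, and such an
  estimate passes to every norming functional.\<close>

lemma hermitian_nonneg:
  assumes H: "hermitian_operator s H" and spec: "\<And>c. c \<in> operator_spectrum s H \<Longrightarrow> 0 \<le> Re c"
    and \<phi>: "supports \<phi> x"
  shows "\<phi> (H x) \<in> \<real>" "0 \<le> Re (\<phi> (H x))"
proof -
  show "\<phi> (H x) \<in> \<real>" by (rule hermitian_supports_real[OF H \<phi>])
  note lin = bounded_operator_D[OF hermitian_operatorD[OF H]]
  have "Re (\<phi> (- H x)) \<le> 0"
  proof (rule norm_estimate_imp_functional_estimate[OF _ _ \<phi>, of "\<lambda>x. - H x"])
    show "linear (\<lambda>x. - H x)" by (intro linearI) (auto simp: lin)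
    show "norm x \<le> norm (x - t *\<^sub>R - H x)" if "0 \<le> t" for x t
      using hermitian_nonneg_spectrum_imp_norm_estimate[OF H spec that] by simp
  qed
  then show "0 \<le> Re (\<phi> (H x))" using \<phi> by (simp add: supports_def dual_space_D)
qed

text \<open>The reflection c -> b - c turns an upper bound on the spectrum into a lower one, so
  \<open>hermitian_nonneg\<close> controls both ends of the numerical range.\<close>

lemma hermitian_const_minus:
  assumes H: "hermitian_operator s H"
  shows "hermitian_operator s (\<lambda>x. b *\<^sub>R x - H x)"
    and "c \<in> operator_spectrum s (\<lambda>x. b *\<^sub>R x - H x) \<Longrightarrow> of_real b - c \<in> operator_spectrum s H"
proof -
  note bH = hermitian_operatorD[OF H]
  note lin = bounded_operator_D[OF bH]
  obtain h where h: "h > 0" "\<And>x. norm (H x) \<le> norm x * h"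
    using bounded_linear.pos_bounded[OF lin(6)] by blast
  have "bounded_operator s (\<lambda>x. b *\<^sub>R x - H x)"
  proof (rule bounded_operatorI[of _ "\<bar>b\<bar> + h"])
    show "norm (b *\<^sub>R x - H x) \<le> norm x * (\<bar>b\<bar> + h)" for x
      using norm_triangle_ineq4[of "b *\<^sub>R x" "H x"] h(2)[of x] by (simp add: distrib_left mult.commute)
    show "b *\<^sub>R s c x - H (s c x) = s c (b *\<^sub>R x - H x)" for c x
      by (simp add: lin scaleR_eq scale_right_diff_distrib mult.commute)
  qed (simp_all add: lin scaleR_right_distrib)
  moreover have "\<phi> (b *\<^sub>R x - H x) \<in> \<real>"
    if "\<phi> \<in> dual_space s" "\<phi> x = 1" "norm x = 1" "onorm \<phi> = 1" for \<phi> x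
    using hermitian_supports_real[OF H supports_iff_onorm[OF that(1,2,4,3)]] that by (simp add: dual_space_D)
  ultimately show "hermitian_operator s (\<lambda>x. b *\<^sub>R x - H x)"
    by (auto simp: hermitian_operator_def numerical_range_def)
  assume c: "c \<in> operator_spectrum s (\<lambda>x. b *\<^sub>R x - H x)"
  show "of_real b - c \<in> operator_spectrum s H"
  proof (rule ccontr)
    assume "of_real b - c \<notin> operator_spectrum s H"
    then have "- (c - of_real b) \<notin> operator_spectrum s H" by simp
    then obtain R where R: "bounded_operator s R" "\<And>x. R (H x + s (c - of_real b) x) = x" "\<And>x. H (R x) + s (c - of_real b) (R x) = x"
      by (rule resolvent_exists) blast
    have eq: "b *\<^sub>R x - H x - s c x = - (H x + s (c - of_real b) x)" for x
      by (simp add: scale_left_diff_distrib scaleR_eq)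
    obtain r where r: "\<And>x. norm (R x) \<le> norm x * r"
      using bounded_linear.bounded[OF bounded_operator_D(6)[OF R(1)]] by blast
    have "bounded_operator s (\<lambda>x. - R x)"
      by (rule bounded_operatorI[of _ r]) (simp_all add: bounded_operator_D[OF R(1)] r)
    moreover have "- R (b *\<^sub>R x - H x - s c x) = x" "b *\<^sub>R (- R x) - H (- R x) - s c (- R x) = x" for x
      unfolding eq using R(2,3) by (simp_all only: bounded_operator_D(7)[OF R(1)] lin(7) scale_minus_right flip: minus_add_distrib) simp_all
    ultimately show False using c unfolding operator_spectrum_def by blast
  qed
qed

section \<open>Norm and numerical range of hermitian operators\<close>

lemma power_iteration_derivative:
  assumes K: "bounded_operator s K" and \<phi>: "\<phi> \<in> dual_space s"
  shows "(\<lambda>z. \<phi> (((\<lambda>y. y + s (z * d) (K y)) ^^ k) x)) holomorphic_on UNIV \<and>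
    ((\<lambda>z. \<phi> (((\<lambda>y. y + s (z * d) (K y)) ^^ k) x)) has_field_derivative of_nat k * d * \<phi> (K x)) (at 0)"
  using \<phi>
proof (induction k arbitrary: \<phi>)
  case (Suc k)
  note lin = dual_space_D[OF Suc.prems] and linK = bounded_operator_D[OF K]
  obtain r where r: "\<And>x. norm (K x) \<le> norm x * r"
    using bounded_linear.bounded[OF linK(6)] by blast
  obtain q where q: "0 \<le> q" "\<And>x. norm (\<phi> x) \<le> norm x * q"
    using bounded_linear.nonneg_bounded[OF lin(6)] by blast
  \<comment> \<open>The outermost factor is moved onto the functional, which replaces
    \<open>\<phi>\<close> by its composition with \<open>K\<close>; hence the induction over all
    functionals.\<close>
  have "(\<lambda>y. \<phi> (K y)) \<in> dual_space s"
  proof (rule dual_space_I[of _ "r * q"])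
    fix x
    have "cmod (\<phi> (K x)) \<le> norm (K x) * q" by (rule q)
    also have "\<dots> \<le> norm x * r * q" using r q by (intro mult_right_mono)
    finally show "cmod (\<phi> (K x)) \<le> norm x * (r * q)" by (simp add: mult.assoc)
  qed (simp_all add: lin linK)
  note IH1 = Suc.IH[OF Suc.prems] and IH2 = Suc.IH[OF this]
  have eq: "(\<lambda>z. \<phi> (((\<lambda>y. y + s (z * d) (K y)) ^^ Suc k) x)) =
      (\<lambda>z. \<phi> (((\<lambda>y. y + s (z * d) (K y)) ^^ k) x) + z * d * \<phi> (K (((\<lambda>y. y + s (z * d) (K y)) ^^ k) x)))"
    by (simp add: lin)
  have id: "((\<lambda>y. y) ^^ k) x = x" by (induction k) auto
  show ?case unfolding eq
  proof
    show "(\<lambda>z. \<phi> (((\<lambda>y. y + s (z * d) (K y)) ^^ k) x) + z * d * \<phi> (K (((\<lambda>y. y + s (z * d) (K y)) ^^ k) x))) holomorphic_on UNIV"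
      using IH1 IH2 by (intro holomorphic_on_add holomorphic_on_mult holomorphic_on_ident holomorphic_on_const) auto
    have "((\<lambda>z. \<phi> (((\<lambda>y. y + s (z * d) (K y)) ^^ k) x) + z * d * \<phi> (K (((\<lambda>y. y + s (z * d) (K y)) ^^ k) x)))
      has_field_derivative of_nat k * d * \<phi> (K x) +
        ((1 * d) * \<phi> (K (((\<lambda>y. y + s (0 * d) (K y)) ^^ k) x)) + (of_nat k * d * \<phi> (K (K x))) * (0 * d))) (at 0)"
      by (intro DERIV_add DERIV_mult DERIV_cmult_right DERIV_ident conjunct2[OF IH1] conjunct2[OF IH2])
    then show "((\<lambda>z. \<phi> (((\<lambda>y. y + s (z * d) (K y)) ^^ k) x) + z * d * \<phi> (K (((\<lambda>y. y + s (z * d) (K y)) ^^ k) x)))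
      has_field_derivative of_nat (Suc k) * d * \<phi> (K x)) (at 0)"
      by (simp add: id algebra_simps)
  qed
qed auto

text \<open>Sinclair's theorem on norms of hermitian operators: Bernstein's inequality at \<open>0\<close> for
  \<open>\<phi> (exp (\<i> z K) x)\<close>. The polynomials \<open>\<phi> ((1 + \<i> z K / N)^N x)\<close> have the same derivative at \<open>0\<close> and
  replace the operator exponential.\<close>

lemma hermitian_contraction:
  assumes K: "bounded_operator s K"
    and num: "\<And>\<phi> y. supports \<phi> y \<Longrightarrow> \<phi> (K y) \<in> \<real> \<and> \<bar>Re (\<phi> (K y))\<bar> \<le> norm y"
  shows "norm (K x) \<le> norm x"
proof -
  note linK = bounded_operator_D[OF K]
  obtain \<kappa> where \<kappa>: "\<kappa> > 0" "\<And>x. norm (K x) \<le> norm x * \<kappa>"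
    using bounded_linear.pos_bounded[OF linK(6)] by blast
  \<comment> \<open>Since \<open>\<phi> (K y)\<close> is real, only Im z contributes to the real
    part of the value at i z K y. This is the source of the growth exp |Im z| in Bernstein's
    inequality.\<close>
  have diss: "(1 - t * \<bar>Im z\<bar>) * norm y \<le> norm (y - t *\<^sub>R s (z * \<i>) (K y))" if "0 \<le> t" for t z y
  proof -
    obtain \<phi> where \<phi>: "supports \<phi> y" using supports_exists by blast
    have d: "\<phi> \<in> dual_space s" "\<And>y. cmod (\<phi> y) \<le> norm y" "\<phi> y = of_real (norm y)"
      using \<phi> by (auto simp: supports_def)
    obtain k where k: "\<phi> (K y) = of_real k" "\<bar>k\<bar> \<le> norm y" using num[OF \<phi>] by (auto elim!: Reals_cases)
    have "Re (\<phi> (y - t *\<^sub>R s (z * \<i>) (K y))) = norm y + t * (Im z * k)"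
      by (simp add: dual_space_D[OF d(1)] d(3) k)
    moreover have "- (\<bar>Im z\<bar> * norm y) \<le> Im z * k"
      using mult_left_mono[OF k(2), of "\<bar>Im z\<bar>"] by (simp add: abs_mult[symmetric] abs_le_iff minus_le_iff)
    then have "t * - (\<bar>Im z\<bar> * norm y) \<le> t * (Im z * k)" using that by (intro mult_left_mono)
    ultimately have "(1 - t * \<bar>Im z\<bar>) * norm y \<le> Re (\<phi> (y - t *\<^sub>R s (z * \<i>) (K y)))"
      by (simp add: algebra_simps)
    also have "\<dots> \<le> norm (y - t *\<^sub>R s (z * \<i>) (K y))" using complex_Re_le_cmod d(2) order_trans by blast
    finally show ?thesis .
  qed
  have step: "norm (y + t *\<^sub>R s (z * \<i>) (K y)) \<le> exp (t * \<bar>Im z\<bar> + t\<^sup>2 * (2 * R\<^sup>2 * \<kappa>\<^sup>2 + 2 * R\<^sup>2)) * norm y"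
    if t: "0 \<le> t" "t * R \<le> 1/2" and z: "\<bar>Re z\<bar> \<le> R" "\<bar>Im z\<bar> \<le> R" for t R z y
  proof -
    define A where "A y = s (z * \<i>) (K y)" for y
    define u where "u = t * \<bar>Im z\<bar>"
    have R0: "0 \<le> R" using z(1) abs_ge_zero order_trans by blast
    have u: "0 \<le> u" "u \<le> 1/2" "u \<le> t * R" using t z mult_left_mono[OF z(2) t(1)] by (auto simp: u_def)
    have linA: "A (y + w) = A y + A w" "A (r *\<^sub>R y) = r *\<^sub>R A y" for y w r
      by (simp_all add: A_def linK scale_right_distrib scaleR_eq mult.commute)
    have z2: "(cmod z)\<^sup>2 \<le> 2 * R\<^sup>2"
      using power_mono[OF z(1) abs_ge_zero, of 2] power_mono[OF z(2) abs_ge_zero, of 2] by (simp add: cmod_power2)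
    have "norm (A (A y)) \<le> (cmod z)\<^sup>2 * (norm y * \<kappa>\<^sup>2)"
    proof -
      have "norm (A (A y)) = (cmod z)\<^sup>2 * norm (K (K y))"
        by (simp add: A_def linK norm_scale norm_mult power2_eq_square)
      also have "norm (K (K y)) \<le> norm (K y) * \<kappa>" by (rule \<kappa>)
      also have "\<dots> \<le> norm y * \<kappa> * \<kappa>" using \<kappa> by (intro mult_right_mono) auto
      finally show ?thesis by (simp add: power2_eq_square mult_left_mono mult.assoc)
    qed
    also have "\<dots> \<le> 2 * R\<^sup>2 * (norm y * \<kappa>\<^sup>2)" using z2 by (intro mult_right_mono) auto
    finally have AA: "norm (A (A y)) \<le> 2 * R\<^sup>2 * \<kappa>\<^sup>2 * norm y" by (simp add: mult_ac)
    \<comment> \<open>The lower bound \<open>diss\<close>, applied to \<open>?w\<close>, becomes an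
      upper bound for \<open>?w\<close>, because (1 - t A) (1 + t A) = 1 - t^2 A^2.\<close>
    let ?w = "y + t *\<^sub>R A y"
    have "(1 - u) * norm ?w \<le> norm (?w - t *\<^sub>R A ?w)" using diss[OF t(1), of z ?w] by (simp add: u_def A_def)
    also have "?w - t *\<^sub>R A ?w = y - t\<^sup>2 *\<^sub>R A (A y)" by (simp add: linA scaleR_right_distrib power2_eq_square)
    also have "norm \<dots> \<le> norm y + t\<^sup>2 * norm (A (A y))"
      using norm_triangle_ineq4[of y "t\<^sup>2 *\<^sub>R A (A y)"] by simp
    also have "\<dots> \<le> norm y + t\<^sup>2 * (2 * R\<^sup>2 * \<kappa>\<^sup>2 * norm y)" using AA by (intro add_left_mono mult_left_mono) auto
    also have "\<dots> = (1 + t\<^sup>2 * (2 * R\<^sup>2 * \<kappa>\<^sup>2)) * norm y" by (simp add: algebra_simps)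
    also have "\<dots> \<le> exp (t\<^sup>2 * (2 * R\<^sup>2 * \<kappa>\<^sup>2)) * norm y" by (intro mult_right_mono exp_ge_add_one_self) auto
    finally have "norm ?w \<le> (1 / (1 - u)) * (exp (t\<^sup>2 * (2 * R\<^sup>2 * \<kappa>\<^sup>2)) * norm y)"
      using u by (simp add: field_simps)
    also have "\<dots> \<le> exp (u + 2 * u\<^sup>2) * (exp (t\<^sup>2 * (2 * R\<^sup>2 * \<kappa>\<^sup>2)) * norm y)"
      using inverse_one_minus_le_exp[OF u(1,2)] by (intro mult_right_mono) auto
    also have "\<dots> = exp (u + 2 * u\<^sup>2 + t\<^sup>2 * (2 * R\<^sup>2 * \<kappa>\<^sup>2)) * norm y" by (simp add: exp_add)
    also have "\<dots> \<le> exp (u + t\<^sup>2 * (2 * R\<^sup>2 * \<kappa>\<^sup>2 + 2 * R\<^sup>2)) * norm y"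
      using power_mono[OF u(3,1), of 2] by (intro mult_right_mono) (auto simp: algebra_simps power_mult_distrib)
    finally show ?thesis by (simp add: A_def u_def)
  qed
  \<comment> \<open>Norming \<open>K x\<close> makes the derivative at 0 equal to i times the norm
    of \<open>K x\<close>.\<close>
  obtain \<phi> where \<phi>: "supports \<phi> (K x)" using supports_exists by blast
  have d: "\<phi> \<in> dual_space s" "\<And>y. cmod (\<phi> y) \<le> norm y" "\<phi> (K x) = of_real (norm (K x))"
    using \<phi> by (auto simp: supports_def)
  have square: "norm (K x) \<le> norm x * (1 + 32 / (pi * (real n * pi)))" if n: "1 \<le> n" for n :: nat
  proof -
    define R where "R = real n * pi"
    \<comment> \<open>Collects the terms of second order: |z|^2 <= 2 R^2 bounds A^2, the rest comes
      from \<open>inverse_one_minus_le_exp\<close>. N steps with t = 1 / N contribute C / N. As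
      \<open>C\<close> grows with \<open>R\<close>, the limit in N precedes the one in n; N >= 2 R
      ensures t R <= 1/2.\<close>
    define C where "C = 2 * R\<^sup>2 * \<kappa>\<^sup>2 + 2 * R\<^sup>2"
    have Rpos: "0 < R" using n by (simp add: R_def)
    have N: "norm (K x) \<le> exp (C / real N) * norm x * (1 + 32 / (pi * R))" if "real N \<ge> 2 * R" for N :: nat
    proof -
      have Npos: "real N > 0" using that Rpos by linarith
      define f where "f z = \<phi> (((\<lambda>y. y + s (z * (\<i> / of_nat N)) (K y)) ^^ N) x)" for z
      have f: "f holomorphic_on UNIV" "(f has_field_derivative of_nat N * (\<i> / of_nat N) * \<phi> (K x)) (at 0)"
        using power_iteration_derivative[OF K d(1), where d = "\<i> / of_nat N" and k = N and x = x] by (auto simp: f_def[abs_def])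
      have "cmod (f z) \<le> exp (C / real N) * norm x * exp \<bar>Im z\<bar>" if z: "\<bar>Re z\<bar> \<le> R" "\<bar>Im z\<bar> \<le> R" for z
      proof -
        define q where "q = exp ((1 / real N) * \<bar>Im z\<bar> + (1 / real N)\<^sup>2 * C)"
        have eq: "s (z * (\<i> / of_nat N)) (K y) = (1 / real N) *\<^sub>R s (z * \<i>) (K y)" for y
          by (simp add: scaleR_eq mult.commute)
        have "norm (y + s (z * (\<i> / of_nat N)) (K y)) \<le> q * norm y" for y
          unfolding eq q_def C_def using that(1) \<open>real N \<ge> 2 * R\<close> Npos z
          by (intro step) (auto simp: field_simps)
        then have "norm (((\<lambda>y. y + s (z * (\<i> / of_nat N)) (K y)) ^^ k) x) \<le> q ^ k * norm x" for k
        proof (induction k)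
          case (Suc k)
          have "norm (((\<lambda>y. y + s (z * (\<i> / of_nat N)) (K y)) ^^ Suc k) x) \<le> q * norm (((\<lambda>y. y + s (z * (\<i> / of_nat N)) (K y)) ^^ k) x)"
            using Suc.prems by simp
          also have "\<dots> \<le> q * (q ^ k * norm x)" using Suc by (intro mult_left_mono) (auto simp: q_def)
          finally show ?case by (simp add: mult.assoc)
        qed simp
        then have "cmod (f z) \<le> q ^ N * norm x" using d(2) order_trans unfolding f_def by blast
        also have "q ^ N = exp (real N * ((1 / real N) * \<bar>Im z\<bar> + (1 / real N)\<^sup>2 * C))"
          unfolding q_def by (rule exp_of_nat_mult[symmetric])
        also have "real N * ((1 / real N) * \<bar>Im z\<bar> + (1 / real N)\<^sup>2 * C) = \<bar>Im z\<bar> + C / real N"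
          using Npos by (simp add: distrib_left power2_eq_square)
        finally show ?thesis by (simp add: exp_add mult_ac)
      qed
      then have "cmod (deriv f 0) \<le> exp (C / real N) * norm x * (1 + 32 / (pi * R))"
        by (intro bernstein_derivative_bound[OF f(1) n R_def]) auto
      moreover have "deriv f 0 = \<i> * of_real (norm (K x))" using DERIV_imp_deriv[OF f(2)] Npos d(3) by simp
      ultimately show ?thesis by (simp add: norm_mult)
    qed
    have "(\<lambda>N. exp (C / real N) * norm x * (1 + 32 / (pi * R))) \<longlonglongrightarrow> exp 0 * norm x * (1 + 32 / (pi * R))"
      by (intro tendsto_intros lim_const_over_n)
    moreover have "\<forall>\<^sub>F N in sequentially. norm (K x) \<le> exp (C / real N) * norm x * (1 + 32 / (pi * R))"
      using eventually_ge_at_top[of "nat \<lceil>2 * R\<rceil>"] by eventually_elim (intro N, linarith)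
    ultimately have "norm (K x) \<le> exp 0 * norm x * (1 + 32 / (pi * R))"
      by (intro tendsto_lowerbound) auto
    then show ?thesis by (simp add: R_def)
  qed
  have "(\<lambda>n. norm x * (1 + 32 / (pi * (real n * pi)))) \<longlonglongrightarrow> norm x * 1"
    by (intro tendsto_mult tendsto_const) real_asymp
  moreover have "\<forall>\<^sub>F n in sequentially. norm (K x) \<le> norm x * (1 + 32 / (pi * (real n * pi)))"
    using eventually_ge_at_top[of 1] by eventually_elim (rule square)
  ultimately have "norm (K x) \<le> norm x * 1" by (intro tendsto_lowerbound) auto
  then show ?thesis by simp
qed

text \<open>Centring: (2 / b) H - 1 has numerical range in [-1, 1], so it is a contraction, and H is
  b / 2 times the sum of this contraction and the identity.\<close>

lemma hermitian_norm_le: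
  assumes H: "hermitian_operator s H" and "0 < b"
    and spec: "\<And>c. c \<in> operator_spectrum s H \<Longrightarrow> 0 \<le> Re c \<and> Re c \<le> b"
  shows "norm (H x) \<le> b * norm x"
proof -
  note bH = hermitian_operatorD[OF H]
  note lin = bounded_operator_D[OF bH]
  define K where "K x = (2 / b) *\<^sub>R H x - x" for x
  obtain h where h: "h > 0" "\<And>x. norm (H x) \<le> norm x * h"
    using bounded_linear.pos_bounded[OF lin(6)] by blast
  have K: "bounded_operator s K"
  proof (rule bounded_operatorI[of _ "2 / b * h + 1"])
    fix x
    have "norm (K x) \<le> (2 / b) * norm (H x) + norm x"
      unfolding K_def using norm_triangle_ineq4[of "(2 / b) *\<^sub>R H x" x] \<open>0 < b\<close> by simp
    also have "\<dots> \<le> (2 / b) * (norm x * h) + norm x" using h(2)[of x] \<open>0 < b\<close> by (intro add_right_mono mult_left_mono) auto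
    finally show "norm (K x) \<le> norm x * (2 / b * h + 1)" by (simp add: algebra_simps)
  next
    show "K (s c x) = s c (K x)" for c x
      by (simp add: K_def lin scaleR_eq scale_right_diff_distrib mult.commute)
  qed (simp add: K_def lin scaleR_right_distrib)
  have "norm (K x) \<le> norm x" for x
  proof (rule hermitian_contraction[OF K])
    fix \<phi> y assume \<phi>: "supports \<phi> y"
    have d: "\<phi> \<in> dual_space s" "\<phi> y = of_real (norm y)" using \<phi> by (auto simp: supports_def)
    have 1: "\<phi> (H y) \<in> \<real>" "0 \<le> Re (\<phi> (H y))" using hermitian_nonneg[OF H _ \<phi>] spec by auto
    have "0 \<le> Re c" if "c \<in> operator_spectrum s (\<lambda>x. b *\<^sub>R x - H x)" for c
      using spec[OF hermitian_const_minus(2)[OF H that]] by simp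
    then have "0 \<le> Re (\<phi> (b *\<^sub>R y - H y))"
      by (rule hermitian_nonneg(2)[OF hermitian_const_minus(1)[OF H] _ \<phi>])
    then have 2: "Re (\<phi> (H y)) \<le> b * norm y" by (simp add: dual_space_D[OF d(1)] d(2))
    obtain r where r: "\<phi> (H y) = of_real r" using 1(1) by (auto elim: Reals_cases)
    define q where "q = 2 / b * r"
    have "\<phi> (K y) = of_real (q - norm y)" by (simp add: K_def dual_space_D[OF d(1)] d(2) r q_def)
    moreover have "0 \<le> q" "q \<le> 2 * norm y" using 1 2 r \<open>0 < b\<close> by (auto simp: q_def field_simps)
    ultimately show "\<phi> (K y) \<in> \<real> \<and> \<bar>Re (\<phi> (K y))\<bar> \<le> norm y"
      by (simp only: Reals_of_real Re_complex_of_real) simp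
  qed
  then have le: "norm (K x + x) \<le> norm x + norm x" by (intro order_trans[OF norm_triangle_ineq] add_right_mono)
  have "H x = (b / 2) *\<^sub>R (K x + x)" using \<open>0 < b\<close> by (simp add: K_def)
  then have "norm (H x) = (b / 2) * norm (K x + x)" using \<open>0 < b\<close> by (metis abs_of_pos half_gt_zero norm_scaleR)
  also have "\<dots> \<le> (b / 2) * (norm x + norm x)" using \<open>0 < b\<close> by (intro mult_left_mono le) simp
  finally show ?thesis by simp
qed

section \<open>Approximate eigenvectors\<close>

lemma spectrum_neighbour:
  assumes H: "bounded_operator s H" and c: "- c \<notin> operator_spectrum s H"
    and m: "\<And>u. m * norm u \<le> norm (H u + s c u)" and near: "cmod (c' - c) < m"
  shows "- c' \<notin> operator_spectrum s H"
proof -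
  note lin = bounded_operator_D[OF H]
  obtain R where R: "bounded_operator s R" "\<And>x. R (H x + s c x) = x" "\<And>x. H (R x) + s c (R x) = x"
    using c by (rule resolvent_exists) blast
  note linR = bounded_operator_D[OF R(1)]
  have mpos: "m > 0" using near norm_ge_zero order_le_less_trans by blast
  have normR: "norm (R x) \<le> norm x / m" for x
    using m[of "R x"] mpos by (simp add: R(3) pos_le_divide_eq mult.commute)
  define m' where "m' = m - cmod (c' - c)"
  have m': "m' > 0" "m' * norm u \<le> norm (H u + s c' u)" for u
    using near shift_lower_bound_perturb[where H = H and c = c and m = m and u = u and c' = c', OF m] by (auto simp: m'_def)
  have inj: "u = v" if "H u + s c' u = H v + s c' v" for u v
  proof -
    have "H (u - v) + s c' (u - v) = 0" using that by (simp add: lin scale_right_diff_distrib algebra_simps)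
    then have "m' * norm (u - v) \<le> 0" using m'(2)[of "u - v"] by simp
    then show ?thesis using m'(1) by (simp add: mult_le_0_iff)
  qed
  \<comment> \<open>The equation is the fixed point problem u = R (y + (c - c') u). As
    \<open>R\<close> has norm at most 1 / m, the map contracts by |c' - c| / m, so the whole disc of
    radius \<open>m\<close> is reached.\<close>
  have "\<exists>u. H u + s c' u = y" for y
  proof -
    have "norm (R (y + s (c - c') u) - R (y + s (c - c') v)) \<le> cmod (c' - c) / m * norm (u - v)" for u v
    proof -
      have "R (y + s (c - c') u) - R (y + s (c - c') v) = s (c - c') (R (u - v))"
        by (simp add: linR scale_right_diff_distrib)
      also have "norm \<dots> \<le> cmod (c - c') * (norm (u - v) / m)"
        unfolding norm_scale by (intro mult_left_mono normR) auto
      finally show ?thesis by (simp add: norm_minus_commute)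
    qed
    then have "\<exists>!u. R (y + s (c - c') u) = u"
      using mpos near by (intro banach_fix_type[of "cmod (c' - c) / m"]) (auto simp: dist_norm)
    then obtain u where "R (y + s (c - c') u) = u" by blast
    then have "H u + s c u = y + s (c - c') u" using R(3)[of "y + s (c - c') u"] by simp
    then show ?thesis by (intro exI[of _ u]) (simp add: scale_left_diff_distrib algebra_simps)
  qed
  then obtain S where S: "\<And>y. H (S y) + s c' (S y) = y" by metis
  have "bounded_operator s S"
  proof (rule bounded_operatorI[of _ "1 / m'"])
    show "S (x + y) = S x + S y" for x y
    proof (rule inj)
      have "H (S x + S y) + s c' (S x + S y) = (H (S x) + s c' (S x)) + (H (S y) + s c' (S y))"
        by (simp add: lin scale_right_distrib add_ac)
      then show "H (S (x + y)) + s c' (S (x + y)) = H (S x + S y) + s c' (S x + S y)" by (simp add: S)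
    qed
    show "S (s a x) = s a (S x)" for a x
    proof (rule inj)
      have "H (s a (S x)) + s c' (s a (S x)) = s a (H (S x) + s c' (S x))"
        by (simp add: lin scale_right_distrib mult.commute)
      then show "H (S (s a x)) + s c' (S (s a x)) = H (s a (S x)) + s c' (s a (S x))" by (simp add: S)
    qed
    show "norm (S x) \<le> norm x * (1 / m')" for x
      using m'(2)[of "S x"] m'(1) by (simp add: S pos_le_divide_eq mult.commute)
  qed
  moreover have "S (H x - s (- c') x) = x" for x by (rule inj) (simp add: S)
  moreover have "H (S x) - s (- c') (S x) = x" for x by (simp add: S)
  ultimately show ?thesis unfolding operator_spectrum_def by blast
qed

text \<open>Otherwise H - 1 is bounded below by \<open>d\<close>. Non-real points belong to the
  resolvent set, and perturbing from them removes the real half line beyond 1 - d / 4 from the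
  spectrum; \<open>hermitian_norm_le\<close> then makes the norm smaller than 1. The cap d <= 1
  keeps 1 - d / 4 positive.\<close>

lemma hermitian_approximate_eigenvector:
  assumes H: "hermitian_operator s H" and spec: "operator_spectrum s H \<subseteq> \<real>\<^sub>\<ge>\<^sub>0"
    and norm_H: "onorm H = 1" and "0 < e"
  shows "\<exists>u. norm u = 1 \<and> norm (H u - u) \<le> e"
proof (rule ccontr)
  assume no: "\<not> ?thesis"
  note bH = hermitian_operatorD[OF H]
  note lin = bounded_operator_D[OF bH]
  define d where "d = min e 1"
  have d: "0 < d" "d \<le> 1" "d \<le> e" using \<open>0 < e\<close> by (auto simp: d_def)
  have below: "d * norm u \<le> norm (H u + s (- 1) u)" for u
  proof (cases "u = 0")
    case False
    let ?v = "(1 / norm u) *\<^sub>R u"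
    have "norm ?v = 1" using False by simp
    then have "e < norm (H ?v - ?v)" using no not_le by blast
    then have "norm u * d \<le> norm u * norm (H ?v - ?v)" using d by (intro mult_left_mono) auto
    also have "\<dots> = norm (norm u *\<^sub>R (H ?v - ?v))" by simp
    also have "norm u *\<^sub>R (H ?v - ?v) = H u - u" using False by (simp add: lin scaleR_right_diff_distrib)
    finally show ?thesis by (simp add: mult.commute)
  qed simp
  have nonreal: "- c \<notin> operator_spectrum s H" if "Im c \<noteq> 0" for c
    using spec that by (auto simp: complex_nonneg_Reals_iff subset_iff)
  have contr: "norm (H u) \<le> norm u" for u using onorm[OF lin(6), of u] norm_H by simp
  have "0 \<le> Re c \<and> Re c \<le> 1 - d / 4" if c: "c \<in> operator_spectrum s H" for c
  proof -
    obtain r where r: "c = of_real r" "0 \<le> r" using c spec by (auto elim!: nonneg_Reals_cases)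
    have "r \<le> 1 - d / 4"
    proof (rule ccontr)
      assume "\<not> r \<le> 1 - d / 4"
      then consider "1 < r" | "1 - d / 4 < r" "r \<le> 1" by linarith
      then have "- (- c) \<notin> operator_spectrum s H"
      proof cases
        case 1
        \<comment> \<open>As \<open>H\<close> is contractive, H - r + i \<eta> is bounded below by r
          - 1. The real point is at distance \<open>\<eta>\<close> from this non-real one, and
          \<open>\<eta>\<close> is below r - 1.\<close>
        define \<eta> where "\<eta> = (r - 1) / 2"
        have "\<eta> > 0" using 1 by (simp add: \<eta>_def)
        have "cmod (- c - Complex (- r) \<eta>) = \<eta>" using r \<open>\<eta> > 0\<close> by (simp add: cmod_def)
        show ?thesis
        proof (rule spectrum_neighbour[OF bH])
          show "- Complex (- r) \<eta> \<notin> operator_spectrum s H" using \<open>\<eta> > 0\<close> by (intro nonreal) simp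
          show "(r - 1) * norm u \<le> norm (H u + s (Complex (- r) \<eta>) u)" for u
          proof -
            have "r * norm u \<le> norm (s (Complex (- r) \<eta>) u)"
              using abs_Re_le_cmod[of "Complex (- r) \<eta>"] by (simp add: norm_scale mult_right_mono)
            then show ?thesis using contr[of u] norm_diff_ineq[of "s (Complex (- r) \<eta>) u" "H u"]
              by (simp add: left_diff_distrib add.commute)
          qed
          show "cmod (- c - Complex (- r) \<eta>) < r - 1" using \<open>cmod _ = \<eta>\<close> 1 by (simp add: \<eta>_def)
        qed
      next
        case 2
        \<comment> \<open>\<open>c0\<close> is within d/2 of -1, so the lower bound \<open>d\<close>
          at -1 leaves d/2 at \<open>c0\<close>, while the real point -r is only d/4 away.\<close>
        define c0 where "c0 = Complex (- r) (d / 4)"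
        have c0: "cmod (- c - c0) = d / 4" using r d by (simp add: cmod_def c0_def)
        have "cmod (c0 - (- 1)) \<le> \<bar>1 - r\<bar> + \<bar>d / 4\<bar>" using cmod_le[of "c0 + 1"] by (simp add: c0_def)
        then have c01: "cmod (c0 - (- 1)) \<le> d / 2" using 2 d by linarith
        show ?thesis
        proof (rule spectrum_neighbour[OF bH])
          show "- c0 \<notin> operator_spectrum s H" using d by (intro nonreal) (simp add: c0_def)
          show "(d / 2) * norm u \<le> norm (H u + s c0 u)" for u
          proof -
            have "(d / 2) * norm u \<le> (d - cmod (c0 - (- 1))) * norm u" using c01 by (intro mult_right_mono) auto
            also have "\<dots> \<le> norm (H u + s c0 u)"
              by (rule shift_lower_bound_perturb[where H = H and c = "- 1", OF below])
            finally show ?thesis .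
          qed
          show "cmod (- c - c0) < d / 2" using c0 d by simp
        qed
      qed
      then show False using c by simp
    qed
    then show ?thesis using r by simp
  qed
  then have "norm (H u) \<le> (1 - d / 4) * norm u" for u
    using d by (intro hermitian_norm_le[OF H]) auto
  then have "onorm H \<le> 1 - d / 4" using d by (intro onorm_bound) auto
  then show False using norm_H d by simp
qed

end

section \<open>The square root series\<close>

text \<open>The Taylor coefficients of \<open>sqrt (1 - t)\<close>.\<close>

definition sqrt_coeff :: "nat \<Rightarrow> real"
  where "sqrt_coeff k = (- 1) ^ k * ((1/2) gchoose k)"

lemma gbinomial_Suc_mult:
  fixes a :: real
  shows "a gchoose Suc k = (a gchoose k) * (a - real k) / real (Suc k)"
  by (simp add: gbinomial_prod_rev)

text \<open>Vandermonde's convolution for 1/2 + 1/2 = 1: the square of the series is 1 - t.\<close>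

lemma sqrt_coeff_convolution:
  "(\<Sum>i\<le>k. sqrt_coeff i * sqrt_coeff (k - i)) = (if k = 0 then 1 else if k = 1 then - 1 else 0)"
proof -
  have "(\<Sum>i\<le>k. sqrt_coeff i * sqrt_coeff (k - i))
      = (\<Sum>i\<le>k. (- 1) ^ k * (((1/2) gchoose i) * ((1/2) gchoose (k - i))))"
  proof (intro sum.cong refl)
    fix i assume "i \<in> {..k}"
    then have "(- 1 :: real) ^ k = (- 1) ^ i * (- 1) ^ (k - i)" by (simp flip: power_add)
    then show "sqrt_coeff i * sqrt_coeff (k - i) = (- 1) ^ k * (((1/2) gchoose i) * ((1/2) gchoose (k - i)))"
      by (simp add: sqrt_coeff_def)
  qed
  also have "\<dots> = (- 1) ^ k * (1 gchoose k)"
    using gbinomial_Vandermonde[of "1/2" "1/2" k] by (simp add: sum_distrib_left atLeast0AtMost flip: sum_distrib_left)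
  also have "(1 gchoose k :: real) = of_nat (1 choose k)" by (simp add: binomial_gbinomial)
  also have "(- 1) ^ k * of_nat (1 choose k) = (if k = 0 then 1 else if k = 1 then - 1 else (0::real))"
    by (cases k) (auto simp: binomial_eq_0)
  finally show ?thesis .
qed

text \<open>After the constant term all coefficients are nonpositive, and the partial sums are the
  nonnegative numbers \<open>d n\<close>; hence the sums of absolute values stay below 2.
  Convergence at t = 1 is the point, as \<open>x\<close> has norm exactly 1.\<close>

lemma summable_abs_sqrt_coeff: "summable (\<lambda>k. \<bar>sqrt_coeff k\<bar>)"
proof -
  have rec: "sqrt_coeff (Suc k) = sqrt_coeff k * (real k - 1/2) / real (Suc k)" for k
    by (simp add: sqrt_coeff_def gbinomial_Suc_mult field_simps)
  have neg: "sqrt_coeff (Suc k) \<le> 0" for k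
  proof (induction k)
    case 0 then show ?case by (simp add: rec) (simp add: sqrt_coeff_def)
  next
    case (Suc k)
    then show ?case by (subst rec) (simp add: divide_nonpos_pos mult_nonpos_nonneg)
  qed
  define d :: "nat \<Rightarrow> real" where "d n = (- 1) ^ n * ((- (1/2)) gchoose n)" for n
  have d: "0 \<le> d n" for n
  proof (induction n)
    case (Suc n)
    have "d (Suc n) = d n * (real n + 1/2) / real (Suc n)"
      by (simp add: d_def gbinomial_Suc_mult field_simps)
    then show ?case using Suc by simp
  qed (simp add: d_def)
  have abs: "\<bar>sqrt_coeff k\<bar> = (if k = 0 then 2 else 0) - sqrt_coeff k" for k
    using neg[of "k - 1"] by (cases k) (auto simp: sqrt_coeff_def)
  have "(\<Sum>k\<le>n. \<bar>sqrt_coeff k\<bar>) = 2 - d n" for n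
  proof -
    have "(\<Sum>k\<le>n. sqrt_coeff k) = d n"
      using gbinomial_sum_lower_neg[of "1/2::real" n] by (simp add: sqrt_coeff_def d_def mult.commute)
    then show ?thesis by (simp add: abs sum_subtractf)
  qed
  then have "(\<Sum>k\<le>n. \<bar>sqrt_coeff k\<bar>) \<le> 2" for n using d[of n] by simp
  then show ?thesis by (intro bounded_imp_summable[of _ 2]) auto
qed

text \<open>The square and the triangle of indices differ by a region on which the terms are
  dominated by M times the scalar ones, and there Cauchy's product theorem gives the limit 0.
  Convergence of either vector sum is not presupposed.\<close>

lemma square_sum_tendsto_convolution:
  fixes B :: "nat \<Rightarrow> 'a::real_normed_vector"
  assumes c: "summable (\<lambda>k. \<bar>c k\<bar>)" and B: "\<And>n. norm (B n) \<le> M"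
  shows "(\<lambda>N. (\<Sum>i<N. \<Sum>j<N. (c i * c j) *\<^sub>R B (i + j)) - (\<Sum>k<N. (\<Sum>i\<le>k. c i * c (k - i)) *\<^sub>R B k)) \<longlonglongrightarrow> 0"
proof -
  define sq tr where "sq N = {..<N} \<times> {..<N}" and "tr N = {(i, j). i + j < N}" for N :: nat
  have tr: "tr N \<subseteq> sq N" "finite (sq N)" for N by (auto simp: sq_def tr_def)
  have sq_sum: "(\<Sum>i<N. \<Sum>j<N. f i j) = (\<Sum>(i,j)\<in>sq N. f i j)" for N and f :: "nat \<Rightarrow> nat \<Rightarrow> 'b::comm_monoid_add"
    unfolding sq_def by (rule sum.cartesian_product)
  have diff: "(\<Sum>(i,j)\<in>sq N. f i j) - (\<Sum>(i,j)\<in>tr N. f i j) = (\<Sum>(i,j)\<in>sq N - tr N. f i j)"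
    for N and f :: "nat \<Rightarrow> nat \<Rightarrow> 'b::ab_group_add"
    using sum_diff[OF tr(2,1), of "case_prod f"] by simp
  define E where "E N = (\<Sum>(i,j)\<in>sq N - tr N. \<bar>c i\<bar> * \<bar>c j\<bar>)" for N
  have "(\<lambda>N. (\<Sum>i<N. \<Sum>j<N. \<bar>c i\<bar> * \<bar>c j\<bar>) - (\<Sum>k<N. \<Sum>i\<le>k. \<bar>c i\<bar> * \<bar>c (k - i)\<bar>)) \<longlonglongrightarrow>
      (\<Sum>k. \<bar>c k\<bar>) * (\<Sum>k. \<bar>c k\<bar>) - (\<Sum>k. \<bar>c k\<bar>) * (\<Sum>k. \<bar>c k\<bar>)"
  proof (intro tendsto_diff)
    have "(\<lambda>N. (\<Sum>i<N. \<bar>c i\<bar>) * (\<Sum>j<N. \<bar>c j\<bar>)) \<longlonglongrightarrow> (\<Sum>k. \<bar>c k\<bar>) * (\<Sum>k. \<bar>c k\<bar>)"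
      by (intro tendsto_mult summable_LIMSEQ c)
    then show "(\<lambda>N. \<Sum>i<N. \<Sum>j<N. \<bar>c i\<bar> * \<bar>c j\<bar>) \<longlonglongrightarrow> (\<Sum>k. \<bar>c k\<bar>) * (\<Sum>k. \<bar>c k\<bar>)"
      by (simp add: sum_product)
    show "(\<lambda>N. \<Sum>k<N. \<Sum>i\<le>k. \<bar>c i\<bar> * \<bar>c (k - i)\<bar>) \<longlonglongrightarrow> (\<Sum>k. \<bar>c k\<bar>) * (\<Sum>k. \<bar>c k\<bar>)"
      using Cauchy_product_sums[of "\<lambda>k. \<bar>c k\<bar>" "\<lambda>k. \<bar>c k\<bar>"] c by (simp add: sums_def)
  qed
  moreover have "(\<Sum>i<N. \<Sum>j<N. \<bar>c i\<bar> * \<bar>c j\<bar>) - (\<Sum>k<N. \<Sum>i\<le>k. \<bar>c i\<bar> * \<bar>c (k - i)\<bar>) = E N" for N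
    unfolding E_def diff[symmetric] sq_sum unfolding tr_def by (simp only: sum.triangle_reindex)
  ultimately have "(\<lambda>N. M * E N) \<longlonglongrightarrow> M * 0" by (intro tendsto_mult tendsto_const) simp
  then have E: "(\<lambda>N. M * E N) \<longlonglongrightarrow> 0" by simp
  have eq: "(\<Sum>i<N. \<Sum>j<N. (c i * c j) *\<^sub>R B (i + j)) - (\<Sum>k<N. (\<Sum>i\<le>k. c i * c (k - i)) *\<^sub>R B k)
      = (\<Sum>(i,j)\<in>sq N - tr N. (c i * c j) *\<^sub>R B (i + j))" for N
  proof -
    have "(\<Sum>k<N. (\<Sum>i\<le>k. c i * c (k - i)) *\<^sub>R B k) = (\<Sum>k<N. \<Sum>i\<le>k. (c i * c (k - i)) *\<^sub>R B (i + (k - i)))"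
      by (simp add: scaleR_sum_left)
    also have "\<dots> = (\<Sum>(i,j)\<in>tr N. (c i * c j) *\<^sub>R B (i + j))"
      unfolding tr_def by (rule sum.triangle_reindex[symmetric])
    finally show ?thesis by (simp only: sq_sum diff)
  qed
  show ?thesis
  proof (rule Lim_null_comparison[OF _ E], intro always_eventually allI)
    fix N
    have "norm (\<Sum>(i,j)\<in>sq N - tr N. (c i * c j) *\<^sub>R B (i + j)) \<le> (\<Sum>(i,j)\<in>sq N - tr N. M * (\<bar>c i\<bar> * \<bar>c j\<bar>))"
      using B by (intro sum_norm_le) (auto simp: abs_mult mult.commute[of M] intro!: mult_left_mono)
    also have "\<dots> = M * E N" by (simp add: E_def sum_distrib_left case_prod_unfold)
    finally show "norm ((\<Sum>i<N. \<Sum>j<N. (c i * c j) *\<^sub>R B (i + j)) - (\<Sum>k<N. (\<Sum>i\<le>k. c i * c (k - i)) *\<^sub>R B k)) \<le> M * E N"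
      unfolding eq .
  qed
qed

section \<open>Powers in a triple\<close>

lemma arithmetic_progression:
  fixes f :: "nat \<Rightarrow> 'a::real_vector"
  assumes "\<And>j. j < n \<Longrightarrow> f (Suc j) - f j = C" "j \<le> n"
  shows "f j = f 0 + real j *\<^sub>R C"
  using assms(2)
proof (induction j)
  case (Suc j)
  then have "f (Suc j) = f j + C" using assms(1)[of j] by (simp add: algebra_simps)
  then show ?case using Suc by (simp add: scaleR_left_distrib)
qed simp

context jb_star_triple
begin

definition tpow :: "'a \<Rightarrow> nat \<Rightarrow> 'a"
  where "tpow x n = ((\<lambda>y. tp x x y) ^^ n) x"

lemma tpow_0 [simp]: "tpow x 0 = x" and tpow_Suc: "tpow x (Suc n) = tp x x (tpow x n)"
  by (simp_all add: tpow_def)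

lemma tp_add1: "tp (x + x') y z = tp x y z + tp x' y z"
  and tp_scale1: "tp (s k x) y z = s k (tp x y z)"
  using tp_linear[of y z] unfolding linear_iff_s by blast+

lemma tp_add3: "tp x y (z + z') = tp x y z + tp x y z'"
  and tp_scale3: "tp x y (s k z) = s k (tp x y z)"
  using tp_add1 tp_scale1 by (simp_all add: tp_symmetric[of x y])

lemma tp_scaleR: "tp (r *\<^sub>R x) y z = r *\<^sub>R tp x y z" "tp x (r *\<^sub>R y) z = r *\<^sub>R tp x y z"
  "tp x y (r *\<^sub>R z) = r *\<^sub>R tp x y z"
  by (simp_all add: scaleR_eq tp_scale1 tp_scale3 tp_conj_scale)

lemma linear_tp: "linear (\<lambda>x. tp x y z)" "linear (\<lambda>y. tp x y z)" "linear (\<lambda>z. tp x y z)"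
  by (auto intro!: linearI simp: tp_add1 tp_conj_add tp_add3 tp_scaleR)

lemmas tp_diff = linear_tp[THEN linear_diff]
lemmas tp_sum = linear_tp[THEN linear_sum]
lemmas tp_zero = linear_tp[THEN linear_0]

lemma tp_bound: "\<exists>C>0. \<forall>a b c. norm (tp a b c) \<le> C * norm a * norm b * norm c"
proof -
  have "isCont (\<lambda>(x, y, z). tp x y z) (0, 0, 0)"
    using tp_continuous by (simp add: continuous_on_eq_continuous_at)
  then obtain d where d: "d > 0" "\<And>p. dist p (0, 0, 0) < d \<Longrightarrow> dist (case p of (x, y, z) \<Rightarrow> tp x y z) (tp 0 0 0) < 1"
    unfolding continuous_at_eps_delta by (auto split: prod.splits) (metis zero_less_one)
  define r where "r = d / 4"
  have r: "r > 0" using d by (simp add: r_def)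
  have small: "norm (tp x y z) \<le> 1" if "norm x \<le> r" "norm y \<le> r" "norm z \<le> r" for x y z
  proof -
    have "norm (x, y, z) \<le> norm x + (norm y + norm z)"
      using norm_Pair_le[of x "(y, z)"] norm_Pair_le[of y z] by linarith
    then have "dist (x, y, z) (0, 0, 0) < d" using that d r by (simp add: dist_norm r_def)
    from d(2)[OF this] show ?thesis by (simp add: tp_zero)
  qed
  have "norm (tp a b c) \<le> (1 / r^3) * norm a * norm b * norm c" for a b c
  proof (cases "a = 0 \<or> b = 0 \<or> c = 0")
    case True then show ?thesis by (auto simp: tp_zero)
  next
    case False
    have "norm (tp ((r / norm a) *\<^sub>R a) ((r / norm b) *\<^sub>R b) ((r / norm c) *\<^sub>R c)) \<le> 1"
      using False r by (intro small) auto
    moreover have "norm (tp ((r / norm a) *\<^sub>R a) ((r / norm b) *\<^sub>R b) ((r / norm c) *\<^sub>R c))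
        = (r / norm a) * (r / norm b) * (r / norm c) * norm (tp a b c)"
      using r by (simp add: tp_scaleR mult.assoc del: times_divide_eq_left times_divide_eq_right)
    moreover have "\<dots> = r^3 * norm (tp a b c) / (norm a * norm b * norm c)"
      by (simp only: power3_eq_cube times_divide_eq_left times_divide_eq_right divide_divide_eq_left
          mult.assoc mult.commute mult.left_commute)
    ultimately have "r^3 * norm (tp a b c) / (norm a * norm b * norm c) \<le> 1" by (simp only:)
    moreover have "norm a * norm b * norm c > 0" using False by simp
    ultimately have "r^3 * norm (tp a b c) \<le> norm a * norm b * norm c" by (simp add: pos_divide_le_eq)
    then have "norm (tp a b c) \<le> norm a * norm b * norm c / r^3" using r by (simp add: pos_le_divide_eq mult.commute)
    then show ?thesis by simp
  qed
  moreover have "1 / r^3 > 0" using r by simp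
  ultimately show ?thesis by blast
qed

lemma bounded_linear_tp: "bounded_linear (tp x y)"
proof -
  obtain C where C: "\<And>a b c. norm (tp a b c) \<le> C * norm a * norm b * norm c" using tp_bound by blast
  show ?thesis
    by (rule bounded_linear_intro[of _ "C * norm x * norm y"]) (use C[of x y] in \<open>auto simp: tp_add3 tp_scaleR mult_ac\<close>)
qed

lemma norm_tp_le: "norm (tp a a y) \<le> (norm a)\<^sup>2 * norm y"
  using onorm[OF bounded_linear_tp, of a a y] by (simp add: L_norm)

lemma norm_tpow_le:
  assumes "norm x \<le> 1" shows "norm (tpow x n) \<le> norm x"
proof (induction n)
  case (Suc n)
  have "norm (tpow x (Suc n)) \<le> (norm x)\<^sup>2 * norm (tpow x n)" unfolding tpow_Suc by (rule norm_tp_le)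
  also have "\<dots> \<le> 1 * norm (tpow x n)" using assms by (intro mult_right_mono) (auto simp: power_le_one)
  finally show ?case using Suc by simp
qed simp

text \<open>The Jordan identity as a commutator: [L(a,b), L(c,d)] = L({a,b,c}, d) - L(c, {b,a,d}),
  where L(a,b) = \<open>tp a b\<close>.\<close>

lemma tp_commutator: "tp a b (tp c d v) = tp c d (tp a b v) + tp (tp a b c) d v - tp c (tp b a d) v"
  using jordan_identity[of a b c d v] by simp

text \<open>Power associativity. The operators \<open>tp (tpow x j) (tpow x (n + 1 - j))\<close> form an arithmetic
  progression in \<open>j\<close>, whose step \<open>C\<close> is the commutator of \<open>tp x x\<close> and \<open>tp (tpow x n) x\<close>; computing
  that commutator the other way round gives \<open>- C = (n + 1) C\<close>.\<close>

lemma tp_tpow: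
  assumes "j + k = n"
  shows "tp (tpow x j) (tpow x k) v = tp (tpow x n) x v"
    and "tp x x (tp (tpow x n) x v) = tp (tpow x n) x (tp x x v)"
proof -
  have "(\<forall>j k v. j + k = n \<longrightarrow> tp (tpow x j) (tpow x k) v = tp (tpow x n) x v) \<and>
      (\<forall>v. tp x x (tp (tpow x n) x v) = tp (tpow x n) x (tp x x v))"
  proof (induction n)
    case (Suc n)
    then have IH: "\<And>j k v. j + k = n \<Longrightarrow> tp (tpow x j) (tpow x k) v = tp (tpow x n) x v"
      and comm: "\<And>v. tp x x (tp (tpow x n) x v) = tp (tpow x n) x (tp x x v)" by blast+
    have step: "tp (tpow x (Suc j)) (tpow x k) v = tp (tpow x j) (tpow x (Suc k)) v" if "j + k = n" for j k v
      using tp_commutator[of x x "tpow x j" "tpow x k" v] by (simp add: IH[OF that] comm tpow_Suc)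
    have desc: "tp (tpow x (Suc n - k)) (tpow x k) v = tp (tpow x (Suc n)) x v" if "k \<le> Suc n" for k v
      using that
    proof (induction k)
      case (Suc k)
      have "tp (tpow x (Suc (n - k))) (tpow x k) v = tp (tpow x (n - k)) (tpow x (Suc k)) v"
        using Suc.prems by (intro step) simp
      then show ?case using Suc by (simp add: Suc_diff_le)
    qed simp
    have all: "tp (tpow x j) (tpow x k) v = tp (tpow x (Suc n)) x v" if "j + k = Suc n" for j k v
    proof -
      have "j = Suc n - k" "k \<le> Suc n" using that by auto
      then show ?thesis using desc by simp
    qed
    define C where "C v = tp (tpow x (Suc (Suc n))) x v - tp (tpow x (Suc n)) (tpow x 1) v" for v
    \<comment> \<open>The commutator with L(x,x) raises one index or the other. By
      \<open>all\<close>, L(x_j, x_k) is the same operator for all j + k = n + 1, so the difference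
      is independent of \<open>j\<close>.\<close>
    have C: "tp (tpow x (Suc j)) (tpow x k) v - tp (tpow x j) (tpow x (Suc k)) v = C v" if "j + k = Suc n" for j k v
    proof -
      have "tp x x (tp (tpow x j) (tpow x k) v) - tp (tpow x j) (tpow x k) (tp x x v)
          = tp (tpow x (Suc j)) (tpow x k) v - tp (tpow x j) (tpow x (Suc k)) v" for j k
        using tp_commutator[of x x "tpow x j" "tpow x k" v] by (simp add: tpow_Suc)
      from this[of j k] this[of "Suc n" 0] show ?thesis by (simp add: all[OF that] C_def)
    qed
    have cube: "tp (tpow x (Suc n)) x x = tpow x (Suc (Suc n))"
      by (simp add: tpow_Suc tp_symmetric)
    have mid: "tp x (tpow x (Suc n)) x = tpow x (Suc (Suc n))"
      using all[of 0 "Suc n" x] cube by simp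
    have C0: "C v = 0" for v
    proof -
      define f where "f j = tp (tpow x j) (tpow x (Suc (Suc n) - j)) v" for j
      have "f (Suc j) - f j = C v" if "j < Suc (Suc n)" for j
        using C[of j "Suc n - j" v] that by (simp add: f_def Suc_diff_le less_Suc_eq_le)
      from arithmetic_progression[of "Suc (Suc n)" f, OF this, of "Suc (Suc n)"]
      have "f (Suc (Suc n)) - f 0 = real (Suc (Suc n)) *\<^sub>R C v" by simp
      then have 1: "tp (tpow x (Suc (Suc n))) x v - tp x (tpow x (Suc (Suc n))) v = real (Suc (Suc n)) *\<^sub>R C v"
        by (simp add: f_def)
      have 2: "tp x x (tp (tpow x (Suc n)) x v) - tp (tpow x (Suc n)) x (tp x x v) = C v"
        using tp_commutator[of x x "tpow x (Suc n)" x v] by (simp add: C_def tpow_Suc)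
      \<comment> \<open>The commutator in reversed order equals the last term minus the first of the
        progression, that is, all n + 2 steps, whereas \<open>2\<close> shows it to be -C.\<close>
      have 3: "tp (tpow x (Suc n)) x (tp x x v) - tp x x (tp (tpow x (Suc n)) x v)
          = tp (tpow x (Suc (Suc n))) x v - tp x (tpow x (Suc (Suc n))) v"
        using tp_commutator[of "tpow x (Suc n)" x x x v] by (simp add: cube mid)
      have "real (Suc (Suc n)) *\<^sub>R C v = - C v" using 1 2 3 by (metis minus_diff_eq)
      then have "real (Suc (Suc n)) *\<^sub>R C v + 1 *\<^sub>R C v = 0" by (simp only: scaleR_one left_minus)
      then have "(real (Suc (Suc n)) + 1) *\<^sub>R C v = 0" by (simp only: scaleR_left_distrib)
      then show ?thesis by simp
    qed
    have "tp x x (tp (tpow x (Suc n)) x v) = tp (tpow x (Suc n)) x (tp x x v)" for v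
      using tp_commutator[of x x "tpow x (Suc n)" x v] C0[of v] by (simp add: C_def tpow_Suc)
    then show ?case using all by blast
  qed simp
  then show "tp (tpow x j) (tpow x k) v = tp (tpow x n) x v"
    "tp x x (tp (tpow x n) x v) = tp (tpow x n) x (tp x x v)" using assms by blast+
qed

lemma tp_tpow_commute: "tp x x (tp (tpow x n) x v) = tp (tpow x n) x (tp x x v)"
  using tp_tpow(2)[of 0 n n x v] by simp

lemma tp_tpow_swap: "tp x (tpow x n) v = tp (tpow x n) x v"
  using tp_tpow(1)[of 0 n n x v] by simp

lemma tpow_tp_x: "tp (tpow x n) x x = tpow x (Suc n)" "tp x (tpow x n) x = tpow x (Suc n)"
  by (simp_all add: tpow_Suc tp_symmetric[of "tpow x n"] tp_tpow_swap)

text \<open>In the model case of operators between Hilbert spaces, \<open>tp (tpow x n) x\<close> is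
  \<open>(\<sigma>^(n+1) + \<rho>^(n+1)) / 2\<close> for the left multiplication \<open>\<sigma>\<close> by \<open>x x*\<close> and the right
  multiplication \<open>\<rho>\<close> by \<open>x* x\<close>. The next identity is Newton's formula for the third power sum of
  two variables.\<close>

lemma tp_tpow_2:
  "tp (tpow x 2) x v = 3 *\<^sub>R tp x x (tp (tpow x 1) x v) - 2 *\<^sub>R tp x x (tp x x (tp x x v))"
proof -
  let ?L = "tp x x"
  define Q where "Q w = tp x w x" for w
  define Y where "Y w = tp (tpow x 1) w x" for w
  have x1: "tp x x x = tpow x 1" by (simp add: tpow_Suc)
  have LQ: "?L (Q w) = 2 *\<^sub>R Y w - Q (?L w)" for w
    using jordan_identity[of x x x w x] by (simp add: Q_def Y_def x1 tp_symmetric[of x w "tpow x (Suc 0)"] scaleR_2)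
  have Y: "Y w = 2 *\<^sub>R ?L (Q w) - Q (?L w)" for w
    using jordan_identity[of x w x x x]
    by (simp add: Q_def Y_def x1 scaleR_2 tp_symmetric[of x w "tpow x (Suc 0)"] tp_symmetric[of "tp x w x" x x] tp_symmetric[of w x x])
  \<comment> \<open>In operator form L Q = 2 Y - Q L and Y = 2 L Q - Q L; eliminating Y shows that L
    and Q commute.\<close>
  have YLQ: "Y w = ?L (Q w)" for w
  proof -
    have num: "(3::real) *\<^sub>R z = 2 *\<^sub>R z + z" "(4::real) *\<^sub>R z = 3 *\<^sub>R z + z" for z :: 'a
      using scaleR_left_distrib[of 2 1 z] scaleR_left_distrib[of 3 1 z] by simp_all
    have "3 *\<^sub>R ?L (Q w) = 3 *\<^sub>R Q (?L w)" using LQ[of w] Y[of w] by (simp add: algebra_simps scaleR_2 num)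
    then have "?L (Q w) = Q (?L w)" by simp
    then show ?thesis using Y[of w] by (simp add: scaleR_2)
  qed
  have L1: "tp (tpow x 1) x v = 2 *\<^sub>R ?L (?L v) - Q (Q v)" for v
    using jordan_identity[of v x x x x]
    by (simp add: Q_def x1 scaleR_2 tp_symmetric[of v x "tpow x (Suc 0)"] tp_symmetric[of v x x] tp_symmetric[of "tp x x v" x x])
  have QQ: "Q (Q v) = 2 *\<^sub>R ?L (?L v) - tp (tpow x 1) x v" by (simp only: L1) simp
  \<comment> \<open>Symmetry moves x_2 = {x_1, x, x} to the third slot, where the Jordan identity
    expands it; \<open>QQ\<close> later removes the square of \<open>Q\<close>.\<close>
  have "tp (tpow x 2) x v = tp v x (tp (tpow x 1) x x)"
    by (simp add: tpow_tp_x tp_symmetric[of v x "tpow x (Suc (Suc 0))"] numeral_2_eq_2)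
  also have "\<dots> = tp (tp v x (tpow x 1)) x x - tp (tpow x 1) (tp x v x) x + tp (tpow x 1) x (tp v x x)"
    by (rule jordan_identity)
  also have "\<dots> = ?L (tp (tpow x 1) x v) - Y (Q v) + tp (tpow x 1) x (?L v)"
    by (simp add: Y_def Q_def tp_symmetric[of v x "tpow x (Suc 0)"] tp_symmetric[of v x x]
        tp_symmetric[of "tp (tpow x (Suc 0)) x v" x x])
  also have "\<dots> = 2 *\<^sub>R ?L (tp (tpow x 1) x v) - ?L (Q (Q v))"
    by (simp add: YLQ scaleR_2 tp_tpow_commute)
  also have "?L (Q (Q v)) = 2 *\<^sub>R ?L (?L (?L v)) - ?L (tp (tpow x 1) x v)"
    by (simp only: QQ tp_diff tp_scaleR)
  finally show ?thesis
    using scaleR_left_distrib[of 1 2 "?L (tp (tpow x 1) x v)"] by (simp add: algebra_simps)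
qed

end

section \<open>States on a triple\<close>

text \<open>For \<beta> > 0 the minimizer is c = p / \<beta>. For \<beta> = 0 a large multiple of
  \<open>p\<close> would make the expression negative; this degenerate case is what makes null
  vectors orthogonal to everything.\<close>

lemma cauchy_schwarz_from_quadratic:
  fixes p :: complex and \<alpha> \<beta> :: real
  assumes pos: "\<And>c. 0 \<le> \<alpha> - 2 * Re (cnj c * p) + (cmod c)\<^sup>2 * \<beta>" and "0 \<le> \<beta>"
  shows "(cmod p)\<^sup>2 \<le> \<alpha> * \<beta>"
proof (cases "\<beta> = 0")
  case False
  then have b: "\<beta> > 0" using assms(2) by simp
  have "0 \<le> \<alpha> - 2 * Re (cnj (p / of_real \<beta>) * p) + (cmod (p / of_real \<beta>))\<^sup>2 * \<beta>" by (rule pos)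
  also have "cnj (p / of_real \<beta>) * p = of_real ((cmod p)\<^sup>2 / \<beta>)"
    by (simp only: complex_cnj_divide complex_cnj_complex_of_real of_real_divide complex_norm_square) (simp add: mult.commute)
  also have "(cmod (p / of_real \<beta>))\<^sup>2 * \<beta> = (cmod p)\<^sup>2 / \<beta>"
    using b by (simp add: norm_divide power_divide power2_eq_square)
  finally have "(cmod p)\<^sup>2 / \<beta> \<le> \<alpha>" by simp
  then show ?thesis using b by (simp add: pos_divide_le_eq)
next
  case True
  have "p = 0"
  proof (rule ccontr)
    assume "p \<noteq> 0"
    then have q: "(cmod p)\<^sup>2 > 0" by simp
    define t where "t = (\<bar>\<alpha>\<bar> + 1) / (cmod p)\<^sup>2"
    have "0 \<le> \<alpha> - 2 * Re (cnj (of_real t * p) * p) + (cmod (of_real t * p))\<^sup>2 * \<beta>" by (rule pos)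
    also have "cnj (of_real t * p) * p = of_real (t * (cmod p)\<^sup>2)"
      by (simp only: complex_norm_square of_real_mult complex_cnj_mult complex_cnj_complex_of_real) (simp add: mult_ac)
    also have "t * (cmod p)\<^sup>2 = \<bar>\<alpha>\<bar> + 1" using q by (simp add: t_def)
    finally show False using True by simp
  qed
  then show ?thesis using True by simp
qed

context jb_star_triple
begin

lemma state_nonneg:
  assumes "supports \<phi> u"
  shows "\<phi> (tp a a u) \<in> \<real>" "0 \<le> Re (\<phi> (tp a a u))"
proof -
  have "0 \<le> Re c" if "c \<in> operator_spectrum s (\<lambda>x. tp a a x)" for c
    using L_spectrum[of a] that by (auto simp: complex_nonneg_Reals_iff)
  from hermitian_nonneg[OF L_hermitian this assms]
  show "\<phi> (tp a a u) \<in> \<real>" "0 \<le> Re (\<phi> (tp a a u))" by blast+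
qed

lemma state_le:
  assumes "supports \<phi> u" "norm u = 1"
  shows "Re (\<phi> (tp a a u)) \<le> (norm a)\<^sup>2"
proof -
  have "Re (\<phi> (tp a a u)) \<le> cmod (\<phi> (tp a a u))" by (rule complex_Re_le_cmod)
  also have "\<dots> \<le> norm (tp a a u)" using assms by (simp add: supports_def)
  also have "\<dots> \<le> (norm a)\<^sup>2 * norm u" by (rule norm_tp_le)
  finally show ?thesis using assms by simp
qed

text \<open>Only the diagonal values are known to be real; polarization with a + b and a + i b
  recovers hermitian symmetry.\<close>

lemma state_cnj:
  assumes \<phi>: "supports \<phi> u"
  shows "\<phi> (tp b a u) = cnj (\<phi> (tp a b u))"
proof -
  have d: "\<phi> \<in> dual_space s" using \<phi> by (simp add: supports_def)
  note lin = dual_space_D[OF d]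
  note expand = tp_add1 tp_conj_add tp_scale1 tp_conj_scale lin
  have im: "Im (\<phi> (tp z z u)) = 0" for z using state_nonneg(1)[OF \<phi>, of z] complex_is_Real_iff by blast
  have "Im (\<phi> (tp a b u)) + Im (\<phi> (tp b a u)) = 0"
    using im[of "a + b"] im[of a] im[of b] by (simp add: expand)
  moreover have "Re (\<phi> (tp b a u)) - Re (\<phi> (tp a b u)) = 0"
    using im[of "a + s \<i> b"] im[of a] im[of b] by (simp add: expand)
  ultimately show ?thesis by (simp add: complex_eq_iff)
qed

lemma state_cauchy_schwarz:
  assumes \<phi>: "supports \<phi> u"
  shows "(cmod (\<phi> (tp a b u)))\<^sup>2 \<le> Re (\<phi> (tp a a u)) * Re (\<phi> (tp b b u))"
proof (rule cauchy_schwarz_from_quadratic)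
  show "0 \<le> Re (\<phi> (tp b b u))" by (rule state_nonneg(2)[OF \<phi>])
  fix c
  have d: "\<phi> \<in> dual_space s" using \<phi> by (simp add: supports_def)
  have "0 \<le> Re (\<phi> (tp (a + s (- c) b) (a + s (- c) b) u))" by (rule state_nonneg(2)[OF \<phi>])
  also have "\<phi> (tp (a + s (- c) b) (a + s (- c) b) u)
      = \<phi> (tp a a u) - (cnj c * \<phi> (tp a b u) + cnj (cnj c * \<phi> (tp a b u))) + (c * cnj c) * \<phi> (tp b b u)"
    by (simp add: tp_add1 tp_conj_add tp_scale1 tp_conj_scale dual_space_D[OF d] state_cnj[OF \<phi>, of b a] del: scale_minus_left)
      (simp add: algebra_simps)
  also have "Re \<dots> = Re (\<phi> (tp a a u)) - 2 * Re (cnj c * \<phi> (tp a b u)) + (cmod c)\<^sup>2 * Re (\<phi> (tp b b u))"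
    by (simp add: complex_norm_square[symmetric])
  finally show "0 \<le> Re (\<phi> (tp a a u)) - 2 * Re (cnj c * \<phi> (tp a b u)) + (cmod c)\<^sup>2 * Re (\<phi> (tp b b u))" .
qed

lemma state_null:
  assumes "supports \<phi> u" "Re (\<phi> (tp b b u)) = 0"
  shows "\<phi> (tp a b u) = 0" "\<phi> (tp b a u) = 0"
  using state_cauchy_schwarz[OF assms(1), of a b] state_cauchy_schwarz[OF assms(1), of b a] assms(2) by simp_all

text \<open>Serves twice: with an approximate eigenvector \<open>u\<close> it bounds the norm of a
  sum of powers from below, and with u = x it is the functional \<open>\<psi>\<close> of the final
  argument.\<close>

lemma state_functional:
  assumes \<phi>: "supports \<phi> u" "norm u = 1" and x: "norm x = 1"
  shows "(\<lambda>z. \<phi> (tp z x u)) \<in> dual_space s" "cmod (\<phi> (tp z x u)) \<le> norm z"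
proof -
  have d: "\<phi> \<in> dual_space s" using \<phi> by (simp add: supports_def)
  show le: "cmod (\<phi> (tp z x u)) \<le> norm z" for z
  proof -
    have "(cmod (\<phi> (tp z x u)))\<^sup>2 \<le> Re (\<phi> (tp z z u)) * Re (\<phi> (tp x x u))" by (rule state_cauchy_schwarz[OF \<phi>(1)])
    also have "\<dots> \<le> (norm z)\<^sup>2 * (norm x)\<^sup>2"
      by (intro mult_mono state_le[OF \<phi>] state_nonneg(2)[OF \<phi>(1)]) auto
    finally show ?thesis using x by (simp add: abs_le_square_iff[symmetric])
  qed
  show "(\<lambda>z. \<phi> (tp z x u)) \<in> dual_space s"
    by (rule dual_space_I[of _ 1]) (use le in \<open>auto simp: tp_add1 tp_scale1 dual_space_D[OF d]\<close>)
qed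

text \<open>Take a state \<open>S \<mapsto> \<phi> (S u)\<close> with \<open>tp x x u\<close> close to \<open>u\<close>, and let \<open>m k\<close> be its value at
  \<open>tp (tpow x k) x\<close>. Then \<open>m 0\<close> is close to 1 and \<open>m 2\<close> is close to \<open>3 * m 1 - 2\<close> by \<open>tp_tpow_2\<close>, so that
  positivity on \<open>x - tpow x 1\<close>, that is \<open>0 \<le> m 0 - 2 * m 1 + m 2\<close>, forces all three to be close to 1.
  The functional \<open>\<lambda>z. \<phi> (tp z x u)\<close> is contractive and takes the value \<open>m k\<close> at \<open>tpow x k\<close>.\<close>

lemma norm_tpow_sum_ge:
  assumes x: "norm x = 1"
  shows "3 \<le> norm (x + tpow x 1 + tpow x 2)"
proof (rule field_le_epsilon)
  fix e :: real assume "0 < e"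
  obtain C where C: "C > 0" "\<And>a b c. norm (tp a b c) \<le> C * norm a * norm b * norm c" using tp_bound by blast
  \<comment> \<open>The errors in \<open>m 0\<close>, \<open>m 1\<close>, \<open>m 2\<close> are 1,
    3 C + 7 and 12 C + 27 times \<open>\<epsilon>\<close>, with sum 15 C + 35.\<close>
  define \<epsilon> where "\<epsilon> = e / (15 * C + 35)"
  have \<epsilon>: "\<epsilon> > 0" using \<open>0 < e\<close> C by (simp add: \<epsilon>_def)
  let ?L = "tp x x"
  have "onorm (\<lambda>y. tp x x y) = 1" using L_norm[of x] x by simp
  then obtain u where u: "norm u = 1" "norm (?L u - u) \<le> \<epsilon>"
    using hermitian_approximate_eigenvector[OF L_hermitian L_spectrum _ \<epsilon>, of x] by blast
  obtain \<phi> where \<phi>: "supports \<phi> u" using supports_exists by blast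
  have d: "\<phi> \<in> dual_space s" "\<And>y. cmod (\<phi> y) \<le> norm y" "\<phi> u = 1" using \<phi> u by (auto simp: supports_def)
  note lin = dual_space_D[OF d(1)]
  define w where "w = ?L u - u"
  have Lu: "?L u = u + w" by (simp add: w_def)
  have L_le: "norm (?L y) \<le> norm y" for y using norm_tp_le[of x y] x by simp
  have w: "norm w \<le> \<epsilon>" "norm (?L w) \<le> \<epsilon>" "norm (?L (?L w)) \<le> \<epsilon>"
    using u L_le[of w] L_le[of "?L w"] by (simp_all add: w_def)
  have Re\<phi>: "\<bar>Re (\<phi> y)\<bar> \<le> t" if "norm y \<le> t" for y t
    using abs_Re_le_cmod[of "\<phi> y"] d(2)[of y] that by linarith
  define m where "m k = \<phi> (tp (tpow x k) x u)" for k
  have m0: "\<bar>Re (m 0) - 1\<bar> \<le> \<epsilon>" using Re\<phi>[OF w(1)] by (simp add: m_def Lu lin d(3))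
  let ?L1 = "tp (tpow x 1) x"
  have L1w: "norm (?L1 w) \<le> C * \<epsilon>"
  proof -
    have "norm (?L1 w) \<le> C * norm (tpow x 1) * norm x * norm w" by (rule C)
    also have "\<dots> \<le> C * 1 * 1 * \<epsilon>"
      using norm_tpow_le[of x 1] x w(1) C(1) by (intro mult_mono) auto
    finally show ?thesis by simp
  qed
  have "tp (tpow x 2) x u = 3 *\<^sub>R (?L1 u + ?L1 w) - 2 *\<^sub>R (u + w + ?L w + ?L (?L w))"
    unfolding tp_tpow_2 tp_tpow_commute by (simp add: Lu tp_add3 add.assoc)
  then have "m 2 = 3 * (m 1 + \<phi> (?L1 w)) - 2 * (1 + \<phi> w + \<phi> (?L w) + \<phi> (?L (?L w)))"
    by (simp only: m_def) (simp add: lin d(3))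
  then have "Re (m 2) = 3 * Re (m 1) - 2 + 3 * Re (\<phi> (?L1 w)) - 2 * (Re (\<phi> w) + Re (\<phi> (?L w)) + Re (\<phi> (?L (?L w))))"
    by simp
  moreover note Re\<phi>[OF L1w, THEN abs_le_D1] Re\<phi>[OF L1w, THEN abs_le_D2]
    Re\<phi>[OF w(1), THEN abs_le_D1] Re\<phi>[OF w(1), THEN abs_le_D2]
    Re\<phi>[OF w(2), THEN abs_le_D1] Re\<phi>[OF w(2), THEN abs_le_D2]
    Re\<phi>[OF w(3), THEN abs_le_D1] Re\<phi>[OF w(3), THEN abs_le_D2]
  ultimately have m2: "\<bar>Re (m 2) - (3 * Re (m 1) - 2)\<bar> \<le> 3 * (C * \<epsilon>) + 6 * \<epsilon>"
    by (intro abs_leI) argo+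
  let ?a = "x - tpow x 1"
  have "tp ?a ?a u = tp x x u - 2 *\<^sub>R tp (tpow x 1) x u + tp (tpow x 2) x u"
    using tp_tpow(1)[of 1 1 2 x u] by (simp add: tp_diff tp_tpow_swap scaleR_2)
  then have "\<phi> (tp ?a ?a u) = m 0 - 2 * m 1 + m 2" by (simp add: m_def lin)
  then have "0 \<le> Re (m 0) - 2 * Re (m 1) + Re (m 2)"
    using state_nonneg(2)[OF \<phi>, of ?a] by simp
  then have m1: "Re (m 1) \<ge> 1 - (3 * (C * \<epsilon>) + 7 * \<epsilon>)" using m0 m2 by linarith
  have "Re (m 0) + Re (m 1) + Re (m 2) = Re (m 0 + m 1 + m 2)" by simp
  also have "\<dots> \<le> cmod (m 0 + m 1 + m 2)" by (rule complex_Re_le_cmod)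
  also have "m 0 + m 1 + m 2 = \<phi> (tp (x + tpow x 1 + tpow x 2) x u)" by (simp add: m_def tp_add1 lin)
  also have "cmod \<dots> \<le> norm (x + tpow x 1 + tpow x 2)" by (rule state_functional(2)[OF \<phi> u(1) x])
  finally have "Re (m 0) + Re (m 1) + Re (m 2) \<le> norm (x + tpow x 1 + tpow x 2)" .
  moreover have "15 * C + 35 \<noteq> 0" using C(1) by linarith
  then have "e = (15 * C + 35) * \<epsilon>" by (simp add: \<epsilon>_def)
  then have "e = 15 * (C * \<epsilon>) + 35 * \<epsilon>" by (simp only: distrib_right mult.assoc)
  ultimately show "3 \<le> norm (x + tpow x 1 + tpow x 2) + e"
    using abs_le_D2[OF m0] abs_le_D2[OF m2] m1 by argo
qed

text \<open>Equality in the triangle inequality: a contractive functional norming the sum has real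
  part at most 1 on each of the three powers and total at least 3, so each value is 1.\<close>

lemma supports_odd_powers:
  assumes x: "norm x = 1"
  shows "\<exists>\<phi>. supports \<phi> x \<and> \<phi> (tpow x 1) = 1 \<and> \<phi> (tpow x 2) = 1"
proof -
  let ?S = "x + tpow x 1 + tpow x 2"
  obtain \<phi> where "supports \<phi> ?S" using supports_exists by blast
  then have d: "\<phi> \<in> dual_space s" "\<And>y. cmod (\<phi> y) \<le> norm y" "\<phi> ?S = of_real (norm ?S)" by (auto simp: supports_def)
  have le: "cmod (\<phi> (tpow x k)) \<le> 1" for k using d(2)[of "tpow x k"] norm_tpow_le[of x k] x by simp
  have "Re (\<phi> x) + Re (\<phi> (tpow x 1)) + Re (\<phi> (tpow x 2)) = norm ?S"
    using arg_cong[OF d(3), of Re] by (simp add: dual_space_D[OF d(1)])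
  moreover have "Re (\<phi> (tpow x k)) \<le> 1" for k using le[of k] complex_Re_le_cmod order_trans by blast
  from this[of 0] this[of 1] this[of 2]
  have "Re (\<phi> (tpow x 0)) \<le> 1" "Re (\<phi> (tpow x 1)) \<le> 1" "Re (\<phi> (tpow x 2)) \<le> 1" .
  ultimately have Re: "Re (\<phi> (tpow x 0)) = 1" "Re (\<phi> (tpow x 1)) = 1" "Re (\<phi> (tpow x 2)) = 1"
    using norm_tpow_sum_ge[OF x] by simp_all
  have "\<phi> (tpow x k) = 1" if "Re (\<phi> (tpow x k)) = 1" for k
  proof -
    have "(Re (\<phi> (tpow x k)))\<^sup>2 + (Im (\<phi> (tpow x k)))\<^sup>2 \<le> 1"
      using power_mono[OF le[of k], of 2] by (simp add: cmod_power2)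
    then show ?thesis using that by (simp add: complex_eq_iff)
  qed
  from this[OF Re(1)] this[OF Re(2)] this[OF Re(3)] show ?thesis
    using d x by (intro exI[of _ \<phi>]) (simp add: supports_def)
qed

text \<open>In the functional calculus of \<open>x\<close>, the element \<open>g\<close> is \<open>t * sqrt (1 - t\<^sup>2)\<close>.\<close>

lemma sqrt_element:
  assumes x: "norm x = 1"
  shows "\<exists>g. \<forall>v. tp g g v = tp x x v - tp (tpow x 1) x v"
proof -
  let ?c = sqrt_coeff
  have le1: "norm (tpow x k) \<le> 1" for k using norm_tpow_le[of x k] x by simp
  have "summable (\<lambda>k. ?c k *\<^sub>R tpow x k)"
    by (rule summable_comparison_test'[OF summable_abs_sqrt_coeff, of 0])
      (use le1 in \<open>auto intro: mult_left_le\<close>)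
  then have G: "(\<lambda>N. \<Sum>k<N. ?c k *\<^sub>R tpow x k) \<longlonglongrightarrow> (\<Sum>k. ?c k *\<^sub>R tpow x k)" by (rule summable_LIMSEQ)
  define G g where "G N = (\<Sum>k<N. ?c k *\<^sub>R tpow x k)" and "g = (\<Sum>k. ?c k *\<^sub>R tpow x k)" for N
  have G: "G \<longlonglongrightarrow> g" using G by (simp add: G_def[abs_def] g_def)
  have "tp g g v = tp x x v - tp (tpow x 1) x v" for v
  proof -
    obtain C where C: "C > 0" "\<And>a b c. norm (tp a b c) \<le> C * norm a * norm b * norm c" using tp_bound by blast
    define B where "B n = tp (tpow x n) x v" for n
    have B: "norm (B n) \<le> C * norm v" for n
    proof -
      have "norm (B n) \<le> C * norm (tpow x n) * norm x * norm v" unfolding B_def by (rule C)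
      also have "\<dots> \<le> C * 1 * 1 * norm v" using le1[of n] x C(1) by (intro mult_mono) auto
      finally show ?thesis by simp
    qed
    \<comment> \<open>By power associativity L(x_i, x_j) depends on i + j only.\<close>
    have GG: "tp (G N) (G N) v = (\<Sum>i<N. \<Sum>j<N. (?c i * ?c j) *\<^sub>R B (i + j))" for N
      by (simp add: G_def tp_sum tp_scaleR B_def tp_tpow(1)[OF refl] scaleR_sum_right add.commute)
    have lim1: "(\<lambda>N. tp (G N) (G N) v) \<longlonglongrightarrow> tp g g v"
    proof -
      have "isCont (\<lambda>(x, y, z). tp x y z) (g, g, v)"
        using tp_continuous by (simp add: continuous_on_eq_continuous_at)
      moreover have "(\<lambda>N. (G N, G N, v)) \<longlonglongrightarrow> (g, g, v)" by (intro tendsto_Pair G tendsto_const)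
      ultimately have "(\<lambda>N. (\<lambda>(x, y, z). tp x y z) (G N, G N, v)) \<longlonglongrightarrow> (\<lambda>(x, y, z). tp x y z) (g, g, v)"
        by (rule isCont_tendsto_compose)
      then show ?thesis by simp
    qed
    have conv: "(\<Sum>k<N. (\<Sum>i\<le>k. ?c i * ?c (k - i)) *\<^sub>R B k) = B 0 - B 1" if "2 \<le> N" for N
    proof -
      have "(\<Sum>k<N. (\<Sum>i\<le>k. ?c i * ?c (k - i)) *\<^sub>R B k)
          = (\<Sum>k\<in>{0, 1}. (\<Sum>i\<le>k. ?c i * ?c (k - i)) *\<^sub>R B k)"
        using that by (intro sum.mono_neutral_right) (auto simp: sqrt_coeff_convolution)
      then show ?thesis by (simp only: sqrt_coeff_convolution) simp
    qed
    have "(\<lambda>N. tp (G N) (G N) v - (\<Sum>k<N. (\<Sum>i\<le>k. ?c i * ?c (k - i)) *\<^sub>R B k)) \<longlonglongrightarrow> 0"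
      unfolding GG by (rule square_sum_tendsto_convolution[OF summable_abs_sqrt_coeff B])
    moreover have "\<forall>\<^sub>F N in sequentially. tp (G N) (G N) v - (\<Sum>k<N. (\<Sum>i\<le>k. ?c i * ?c (k - i)) *\<^sub>R B k)
        = tp (G N) (G N) v - (B 0 - B 1)"
      using eventually_ge_at_top[of 2] by eventually_elim (simp only: conv)
    ultimately have "(\<lambda>N. tp (G N) (G N) v - (B 0 - B 1)) \<longlonglongrightarrow> 0" by (rule Lim_transform_eventually)
    then have "(\<lambda>N. tp (G N) (G N) v) \<longlonglongrightarrow> B 0 - B 1" by (simp add: LIM_zero_iff)
    with lim1 have "tp g g v = B 0 - B 1" by (rule LIMSEQ_unique)
    then show ?thesis by (simp add: B_def)
  qed
  then show ?thesis by blast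
qed

end

section \<open>Derivations\<close>

context jb_star_triple
begin

text \<open>Since \<open>\<phi>\<close> vanishes on \<open>tp g y x\<close> and \<open>tp y g x\<close>, the derivation \<open>\<delta>\<close> is only ever applied to \<open>x\<close>,
  \<open>g\<close> and powers of \<open>x\<close>, and its possible discontinuity does no harm.\<close>

lemma derivation_support:
  assumes \<delta>: "triple_derivation s tp \<delta>" and x: "norm x = 1"
  shows "\<exists>\<psi>\<in>dual_space s. (\<forall>y. cmod (\<psi> y) \<le> norm y) \<and> \<psi> x = 1 \<and> Re (\<psi> (\<delta> x)) = 0"
proof -
  have lin\<delta>: "Vector_Spaces.linear s s \<delta>" and der: "\<delta> (tp a b c) = tp (\<delta> a) b c + tp a (\<delta> b) c + tp a b (\<delta> c)" for a b c
    using \<delta> by (auto simp: triple_derivation_def)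
  obtain \<phi> where \<phi>: "supports \<phi> x" "\<phi> (tpow x 1) = 1" "\<phi> (tpow x 2) = 1" using supports_odd_powers[OF x] by blast
  have d: "\<phi> \<in> dual_space s" "\<phi> x = 1" using \<phi> x by (auto simp: supports_def)
  note lin = dual_space_D[OF d(1)]
  define x1 x2 z where "x1 = tpow x 1" and "x2 = tpow x 2" and "z = \<delta> x"
  have x1: "x1 = tp x x x" and x2: "x2 = tp x x1 x" "x2 = tp x1 x x"
    using tpow_tp_x[of x 1] by (simp_all add: x1_def x2_def tpow_Suc numeral_2_eq_2)
  define \<psi> where "\<psi> y = \<phi> (tp y x x)" for y
  have \<psi>: "\<psi> \<in> dual_space s" "\<And>y. cmod (\<psi> y) \<le> norm y"
    using state_functional[OF \<phi>(1) x x] by (simp_all add: \<psi>_def[abs_def])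
  note lin\<psi> = dual_space_D[OF \<psi>(1)]
  have \<psi>x: "\<psi> x = 1" using \<phi>(2) by (simp add: \<psi>_def x1_def tpow_Suc)
  have c1: "\<phi> (tp x x x) = 1" "\<phi> (tp x1 x x) = 1" using \<phi>(2,3) x1 x2 by (simp_all add: x1_def x2_def)
  \<comment> \<open>The value is 1 - 1 - 1 + [x_1, x_1], and the last term is at most 1. Hence x_1
    may be replaced by x in either slot of the form.\<close>
  have null: "Re (\<phi> (tp (x - x1) (x - x1) x)) = 0"
  proof -
    have le: "Re (\<phi> (tp x1 x1 x)) \<le> 1"
      using state_le[OF \<phi>(1) x, of x1] norm_tpow_le[of x 1] x by (simp add: x1_def) (smt (verit) norm_ge_zero power_le_one)
    have "\<phi> (tp (x - x1) (x - x1) x) = \<phi> (tp x x x) - \<phi> (tp x x1 x) - \<phi> (tp x1 x x) + \<phi> (tp x1 x1 x)"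
      by (simp add: tp_diff lin)
    also have "\<phi> (tp x x1 x) = 1" using x2 c1 by simp
    finally have "Re (\<phi> (tp (x - x1) (x - x1) x)) \<le> 0" using le c1 by simp
    then show ?thesis using state_nonneg(2)[OF \<phi>(1), of "x - x1"] by linarith
  qed
  have yx1: "\<phi> (tp y x1 x) = \<psi> y" for y
    using state_null(1)[OF \<phi>(1) null, of y] by (simp add: tp_diff lin \<psi>_def)
  have x1y: "\<phi> (tp x1 y x) = cnj (\<psi> y)" for y
    using state_cnj[OF \<phi>(1), of x1 y] yx1[of y] by simp
  have xy: "\<phi> (tp x y x) = cnj (\<psi> y)" for y
    using state_cnj[OF \<phi>(1), of x y] by (simp add: \<psi>_def)
  have swap: "tp x1 x v = tp x x1 v" for v using tp_tpow_swap[of x 1 v] by (simp add: x1_def)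
  have yxx1: "\<phi> (tp y x x1) = \<psi> y" for y
    using yx1[of y] by (simp add: tp_symmetric[of y x x1] swap tp_symmetric[of x x1 y])
  obtain g where g: "\<And>v. tp g g v = tp x x v - tp x1 x v" using sqrt_element[OF x] by (auto simp: x1_def)
  have "\<phi> (tp g g x) = 0" using c1 by (simp add: g lin)
  then have g0: "\<phi> (tp y g x) = 0" "\<phi> (tp g y x) = 0" for y using state_null[OF \<phi>(1), of g y] by auto
  have e1: "\<delta> (tp g g x) = \<delta> x1 - \<delta> x2"
    using linear_diff[OF linear_real[OF lin\<delta>]] by (simp add: g flip: x1 x2(2))
  \<comment> \<open>The term in which \<open>\<delta>\<close> falls on \<open>x\<close>; it uses the
    formula for {g,g,v} at v = \<delta> x, which lies outside the subtriple generated by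
    \<open>x\<close> in general.\<close>
  have "\<phi> (tp g g z) = 0"
    using yxx1[of z] by (simp add: g lin \<psi>_def tp_symmetric[of z x x1] tp_symmetric[of z x x])
  then have "\<phi> (\<delta> x1) - \<phi> (\<delta> x2) = 0"
    using arg_cong[OF e1, of \<phi>] by (simp add: der lin g0 z_def)
  moreover have "\<phi> (\<delta> x1) = 2 * \<psi> z + cnj (\<psi> z)"
    by (simp add: x1 der lin xy \<psi>_def z_def tp_symmetric[of x x "\<delta> x"])
  moreover have "\<phi> (\<delta> x2) = 2 * \<psi> z + cnj (\<psi> (\<delta> x1))"
    using yx1[of "\<delta> x"] by (simp add: x2(1) der lin xy z_def tp_symmetric[of x x1 "\<delta> x"])
  ultimately have e2: "\<psi> (\<delta> x1) = \<psi> z" by (simp add: complex_eq_iff)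
  \<comment> \<open>The Jordan identity with \<open>z\<close> in the first and in the second slot
    gives two relations; after conjugating the second, \<psi> z = 2 A - B = 2 B - A, which
    determines both unknowns.\<close>
  define A B where "A = \<psi> (tp z x x)" and "B = cnj (\<psi> (tp x z x))"
  have AB1: "\<psi> z = 2 * A - B"
    using arg_cong[OF jordan_identity[of z x x x x], of \<phi>]
    by (simp add: lin A_def B_def flip: x1) (simp add: yxx1 xy \<psi>_def tp_symmetric[of x x "tp z x x"])
  have AB2: "cnj (\<psi> z) = 2 * cnj B - cnj A"
    using arg_cong[OF jordan_identity[of x z x x x], of \<phi>]
    by (simp add: lin A_def B_def flip: x1)
      (simp add: x1y xy tp_symmetric[of x z x1] tp_symmetric[of x x "tp x z x"] \<psi>_def)
  have "A = \<psi> z" "B = \<psi> z" using AB1 AB2 by (auto simp: complex_eq_iff)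
  moreover have "\<psi> (\<delta> x1) = 2 * A + cnj B"
    by (simp add: x1 der lin\<psi> A_def B_def z_def tp_symmetric[of x x "\<delta> x"])
  ultimately have "Re (\<psi> z) = 0" using e2 by (simp add: complex_eq_iff)
  then show ?thesis using \<psi> \<psi>x by (auto simp: z_def)
qed

text \<open>The weak-local hypothesis picks the derivation after \<open>\<phi>\<close>, so the
  functional cannot be adapted to the derivation; the detour through the norm estimate reaches the
  prescribed \<open>\<phi>\<close>.\<close>

lemma derivation_dissipative:
  assumes \<delta>: "triple_derivation s tp \<delta>" and \<phi>: "supports \<phi> x"
  shows "Re (\<phi> (\<delta> x)) \<le> 0"
proof -
  have lin: "Vector_Spaces.linear s s \<delta>" using \<delta> by (simp add: triple_derivation_def)
  show ?thesis
  proof (rule norm_estimate_imp_functional_estimate[OF linear_real[OF lin] _ \<phi>])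
    show "norm x \<le> norm (x - t *\<^sub>R \<delta> x)" if "0 \<le> t" for x t
      by (rule functional_estimate_imp_norm_estimate[OF lin _ that]) (use derivation_support[OF \<delta>] in fastforce)
  qed
qed

lemma weak_local_triple_derivation_dissipative:
  assumes T: "weak_local_triple_derivation s tp T"
  shows "dissipative s T" "continuous_on UNIV T"
proof -
  have lin: "Vector_Spaces.linear s s T"
    and ex: "\<And>\<phi> a. \<phi> \<in> dual_space s \<Longrightarrow> \<exists>\<delta>. triple_derivation s tp \<delta> \<and> \<phi> (T a) = \<phi> (\<delta> a)"
    using T by (auto simp: weak_local_triple_derivation_def)
  have supp: "Re (\<phi> (T x)) \<le> 0" if "supports \<phi> x" for \<phi> x
    using ex[of \<phi> x] derivation_dissipative[OF _ that] that by (auto simp: supports_def)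
  then show "dissipative s T"
    using lin supports_iff_onorm by (auto simp: dissipative_def)
  have "norm x \<le> norm (x - t *\<^sub>R T x)" if "0 \<le> t" for x t
  proof (rule functional_estimate_imp_norm_estimate[OF lin _ that])
    fix x :: 'a assume "norm x = 1"
    obtain \<phi> where \<phi>: "supports \<phi> x" using supports_exists by blast
    then show "\<exists>\<phi>\<in>dual_space s. (\<forall>y. cmod (\<phi> y) \<le> norm y) \<and> \<phi> x = 1 \<and> Re (\<phi> (T x)) \<le> 0"
      using supp[OF \<phi>] \<open>norm x = 1\<close> by (auto simp: supports_def)
  qed
  then have "bounded_linear T" by (rule dissipative_estimate_bounded_linear[OF linear_real[OF lin]])
  then show "continuous_on UNIV T" by (rule linear_continuous_on)
qed

end


theorem theorem2p1:
  fixes s :: "complex \<Rightarrow> 'a::banach \<Rightarrow> 'a"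
    and tp :: "'a \<Rightarrow> 'a \<Rightarrow> 'a \<Rightarrow> 'a"
    and T :: "'a \<Rightarrow> 'a"
  assumes "jb_star_triple s tp"
    and "weak_local_triple_derivation s tp T"
  shows "dissipative s T \<and> continuous_on UNIV T"
  using jb_star_triple.weak_local_triple_derivation_dissipative[OF assms] by blast

end
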